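(* The unit sphere of the Holmes space $\langle\mathbf{U}\rangle$ is approximately indivisible.
   Context: The Urysohn space $\mathbf{U}$ is the unique (up to isometry) complete separable ultrahomogeneous metric space into which every finite metric space embeds isometrically (ultrahomogeneous: every isometry between finite subspaces extends to an isometry of the whole space onto itself). By a theorem of Holmes there is a Banach space $\langle\mathbf{U}\rangle$ (the Holmes space), unique up to isometric isomorphism, such that for every isometric embedding $i:\mathbf{U}\to Y$ of $\mathbf{U}$ into a Banach space $Y$ with $0_Y$ in the range of $i$, there is an isometric isomorphism between $\langle\mathbf{U}\rangle$ and the closed linear span of $i(\mathbf{U})$ in $Y$. Its unit sphere is viewed as a metric space with the distance induced by the norm. For a metric space $X$, $A\subset X$ and $\varepsilon>0$, let $(A)_\varepsilon=\{x\in X:\exists y\in A\ d(x,y)\leqslant\varepsilon\}$. $X$ is $\varepsilon$-indivisible when for every integer $k\geqslant1$ and every $\chi:X\to\{0,\dots,k-1\}$ there are $i<k$ and a subspace $\widetilde X\subset X$ isometric to $X$ (as a metric space) with $\widetilde X\subset(\chi^{-1}(\{i\}))_\varepsilon$. $X$ is approximately indivisible when it is $\varepsilon$-indivisible for every $\varepsilon>0$. *)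

theory Defs
  imports "HOL-Analysis.Analysis"
begin

text \<open>The library has this instance only for metric domains; \<^typ>\<open>nat\<close> is merely a (discrete)
  topological space.\<close>

instance bcontfun :: (topological_space, complete_space) complete_space
proof
  fix f :: "nat \<Rightarrow> ('a, 'b) bcontfun"
  assume "Cauchy f"
  then obtain g where "uniform_limit UNIV f g sequentially"
    using uniformly_convergent_eq_cauchy[of "\<lambda>_. True" f]
    unfolding Cauchy_def uniform_limit_sequentially_iff
    by (metis dist_fun_lt_imp_dist_val_lt)
  then show "convergent f"
    using uniform_limit_bcontfunE[OF _ sequentially_bot] convergentI by metis
qed

instance bcontfun :: (topological_space, banach) banach ..

definition isometry_on :: "'a::metric_space set \<Rightarrow> ('a \<Rightarrow> 'b::metric_space) \<Rightarrow> bool" where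
  "isometry_on X f \<longleftrightarrow> (\<forall>x\<in>X. \<forall>y\<in>X. dist (f x) (f y) = dist x y)"

definition isometric :: "'a::metric_space set \<Rightarrow> 'b::metric_space set \<Rightarrow> bool" where
  "isometric X Y \<longleftrightarrow> (\<exists>f. isometry_on X f \<and> f ` X = Y)"

definition ultrahomogeneous :: "'a::metric_space set \<Rightarrow> bool" where
  "ultrahomogeneous X \<longleftrightarrow>
     (\<forall>F f. finite F \<and> F \<subseteq> X \<and> f ` F \<subseteq> X \<and> isometry_on F f \<longrightarrow>
        (\<exists>g. isometry_on X g \<and> g ` X = X \<and> (\<forall>x\<in>F. g x = f x)))"

text \<open>Every finite metric space is isometric to one whose points are natural numbers, so
  quantifying over finite metrics on subsets of \<^typ>\<open>nat\<close> covers all of them.\<close>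

definition embeds_finite_metric_spaces :: "'a::metric_space set \<Rightarrow> bool" where
  "embeds_finite_metric_spaces X \<longleftrightarrow>
     (\<forall>(M :: nat set) d. finite M \<and> Metric_space M d \<longrightarrow>
        (\<exists>f. f ` M \<subseteq> X \<and> (\<forall>x\<in>M. \<forall>y\<in>M. dist (f x) (f y) = d x y)))"

definition urysohn_space :: "'a::metric_space set \<Rightarrow> bool" where
  "urysohn_space U \<longleftrightarrow>
     complete U \<and> separable_space (top_of_set U) \<and>
     ultrahomogeneous U \<and> embeds_finite_metric_spaces U"

definition isometrically_isomorphic_to ::
    "'h::banach itself \<Rightarrow> 'y::banach set \<Rightarrow> bool" where
  "isometrically_isomorphic_to _ S \<longleftrightarrow>
     (\<exists>T :: 'h \<Rightarrow> 'y. linear T \<and> (\<forall>x. norm (T x) = norm x) \<and> range T = S)"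

text \<open>The universal property of the Holmes space over \<^term>\<open>U\<close>, for embeddings into one given
  Banach space \<open>'y\<close>.\<close>

definition holmes_property ::
    "'u::metric_space set \<Rightarrow> 'h::banach itself \<Rightarrow> 'y::banach itself \<Rightarrow> bool" where
  "holmes_property U H _ \<longleftrightarrow>
     (\<forall>i :: 'u \<Rightarrow> 'y. isometry_on U i \<and> 0 \<in> i ` U \<longrightarrow>
        isometrically_isomorphic_to H (closure (span (i ` U))))"

text \<open>A formula of HOL cannot quantify over all Banach space types \<open>'y\<close>, so the target is fixed to
  be the space of bounded real sequences with the supremum norm. Nothing is lost: the closed linear
  span of a copy of the separable space \<open>U\<close> is separable, and by Hahn-Banach every separable Banach
  space embeds linearly and isometrically into this one, so the property for this target
  implies it for every target. As a hypothesis it is in any case an instance of the property for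
  all targets. It is not vacuous, since \<open>U\<close> embeds into this space (Frechet embedding) with
  \<open>0\<close> in the range.\<close>

definition holmes_space :: "'u::metric_space set \<Rightarrow> 'h::banach itself \<Rightarrow> bool" where
  "holmes_space U H \<longleftrightarrow> holmes_property U H TYPE(nat \<Rightarrow>\<^sub>C real)"

definition closed_nbhd :: "'a::metric_space set \<Rightarrow> real \<Rightarrow> 'a set \<Rightarrow> 'a set" where
  "closed_nbhd X \<epsilon> A = {x \<in> X. \<exists>y\<in>A. dist x y \<le> \<epsilon>}"

definition eps_indivisible :: "real \<Rightarrow> 'a::metric_space set \<Rightarrow> bool" where
  "eps_indivisible \<epsilon> X \<longleftrightarrow>
     (\<forall>k::nat. k \<ge> 1 \<longrightarrow> (\<forall>c \<in> X \<rightarrow> {..<k}.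
        \<exists>i<k. \<exists>X' \<subseteq> X. isometric X' X \<and> X' \<subseteq> closed_nbhd X \<epsilon> (c -` {i} \<inter> X)))"

definition approximately_indivisible :: "'a::metric_space set \<Rightarrow> bool" where
  "approximately_indivisible X \<longleftrightarrow> (\<forall>\<epsilon>>0. eps_indivisible \<epsilon> X)"

end

theory Submission
  imports Defs
begin

text \<open>The unit sphere of the Holmes space contains a copy of the sphere of radius \<open>1\<close> around a
  point of \<open>U\<close>, and every countable pseudometric space of diameter at most \<open>2\<close> embeds into that one
  (\<open>holmes_sphere_universal\<close>); it is itself separable, complete and of diameter \<open>2\<close>. So it is enough
  to find, for a dense sequence \<open>q\<^sub>0, q\<^sub>1, \<dots>\<close> of the sphere and for \<open>p > 0\<close>, one countable
  pseudometric space \<open>A\<close> of diameter at most \<open>2\<close> with this property: for every finite colouring of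
  \<open>A\<close> there are points \<open>y\<^sub>n\<close> of \<open>A\<close> with the same mutual distances as the \<open>q\<^sub>n\<close>, and each \<open>y\<^sub>n\<close> lies
  within \<open>2 / p\<close> of a point \<open>z\<^sub>n\<close> of one fixed colour (\<open>words_near_one_colour\<close>). Embedding \<open>A\<close> into the
  sphere and extending \<open>q\<^sub>n \<mapsto> y\<^sub>n\<close> by completeness gives the required copy of the sphere.\<close>

text \<open>The points of \<open>A\<close> are finite words with letters in \<open>[0, 2]\<close>, among them \<open>0\<close>. The \<open>l\<close>-th letter of a word \<open>v\<close> is
  read as the distance from \<open>v\<close> to an anonymous \<open>l\<close>-th landmark, and the letter \<open>2\<close>, with which all
  words are padded, bounds no distance from above. If \<open>v\<close> and \<open>w\<close> are points of a metric space then
  \<open>\<bar>v\<^sub>l - w\<^sub>l\<bar> \<le> d(v, w) \<le> v\<^sub>l + w\<^sub>l\<close> for all landmarks. The formula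
  \<open>d(v, w) = min(2, inf\<^sub>l max(v\<^sub>l + w\<^sub>l, max\<^sub>i\<^sub><\<^sub>l \<bar>v\<^sub>i - w\<^sub>i\<bar>))\<close> reads the landmarks one after the other until the
  lower bounds seen so far meet an upper bound; it satisfies the triangle inequality
  whether or not the words come from points of a metric space (\<open>word_dist_triangle\<close>).\<close>

text \<open>Let \<open>x\<^sub>0, x\<^sub>1, \<dots>\<close> be any words each containing the letter \<open>0\<close>. Code the \<open>n\<close>-th point of a metric
  space by the word whose \<open>i\<close>-th block, for \<open>i \<le> n\<close>, is \<open>x\<^sub>i\<close> with all letters raised by \<open>d(n, i)\<close>
  and cut off at \<open>2\<close>; the last block is \<open>x\<^sub>n\<close> itself. This code is isometric (\<open>word_dist_code\<close>):
  a letter \<open>0\<close> of \<open>x\<^sub>m\<close> shows up as \<open>0\<close> in the \<open>m\<close>-th code and as \<open>d(n, m)\<close> in the \<open>n\<close>-th one, which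
  gives both bounds. Rounding the shifts to multiples of \<open>2 / p\<close> moves a code word by at most
  \<open>2 / p\<close>. With rounded shifts and the letters of the \<open>x\<^sub>i\<close> in the grid \<open>{0, 2/p, \<dots>, 2}\<close>, the code
  words become the words of Gowers' theorem on \<open>FIN\<^sub>p\<close>: a letter \<open>a \<le> p\<close> stands for the distance
  \<open>2 - 2a/p\<close>, raising a distance becomes truncated subtraction, and a suitable ultrafilter produces
  \<open>x\<^sub>0, x\<^sub>1, \<dots>\<close> for which all rounded code words have one colour (\<open>gowers_shifted_words\<close>). So the \<open>y\<^sub>n\<close>
  are the exact code words of the \<open>q\<^sub>n\<close>, and the \<open>z\<^sub>n\<close> the rounded ones.\<close>

section \<open>Idempotent ultrafilters on words\<close>

text \<open>The product of ultrafilters on the free semigroup of words, written for all filters. Filters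
  stand for the closed subsets of the Stone-Cech compactification of that semigroup, a finer filter
  for a smaller set, so that no topology on the space of ultrafilters has to be set up.\<close>

definition conv :: "'a list filter \<Rightarrow> 'a list filter \<Rightarrow> 'a list filter" where
  "conv F G = Abs_filter (\<lambda>P. \<forall>\<^sub>F x in F. \<forall>\<^sub>F y in G. P (x @ y))"

lemma eventually_conv:
  "eventually P (conv F G) \<longleftrightarrow> (\<forall>\<^sub>F x in F. \<forall>\<^sub>F y in G. P (x @ y))"
  unfolding conv_def
proof (rule eventually_Abs_filter, rule is_filter.intro)
  fix P Q assume "\<forall>\<^sub>F x in F. \<forall>\<^sub>F y in G. P (x @ y)" "\<forall>\<^sub>F x in F. \<forall>\<^sub>F y in G. Q (x @ y)"
  then show "\<forall>\<^sub>F x in F. \<forall>\<^sub>F y in G. P (x @ y) \<and> Q (x @ y)"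
    by eventually_elim (rule eventually_conj)
next
  fix P Q :: "'a list \<Rightarrow> bool" assume "\<forall>x. P x \<longrightarrow> Q x" "\<forall>\<^sub>F x in F. \<forall>\<^sub>F y in G. P (x @ y)"
  then show "\<forall>\<^sub>F x in F. \<forall>\<^sub>F y in G. Q (x @ y)"
    by (auto elim!: eventually_mono)
qed simp

lemma conv_assoc: "conv (conv F G) H = conv F (conv G H)"
  by (simp add: filter_eq_iff eventually_conv)

lemma conv_mono: "F \<le> F' \<Longrightarrow> G \<le> G' \<Longrightarrow> conv F G \<le> conv F' G'"
  by (auto simp: le_filter_def eventually_conv elim!: eventually_mono)

lemma conv_neq_bot: "F \<noteq> bot \<Longrightarrow> G \<noteq> bot \<Longrightarrow> conv F G \<noteq> bot"
  by (simp add: trivial_limit_def eventually_conv)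

lemma filtermap_conv:
  "filtermap (map f) (conv F G) = conv (filtermap (map f) F) (filtermap (map f) G)"
  by (simp add: filter_eq_iff eventually_conv eventually_filtermap)

definition ultra :: "'a filter \<Rightarrow> bool" where
  "ultra F \<longleftrightarrow> F \<noteq> bot \<and> (\<forall>P. eventually P F \<or> (\<forall>\<^sub>F x in F. \<not> P x))"

lemma ultra_not: "ultra F \<Longrightarrow> (\<forall>\<^sub>F x in F. \<not> P x) \<longleftrightarrow> \<not> eventually P F"
  using eventually_conj[of P F "\<lambda>x. \<not> P x"] by (auto simp: ultra_def trivial_limit_def)

lemma ultra_eqI:
  assumes "ultra F" "G \<noteq> bot" "G \<le> F"
  shows "G = F"
proof (rule antisym[OF \<open>G \<le> F\<close>], rule filter_leI)
  fix P assume P: "eventually P G"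
  show "eventually P F"
  proof (rule ccontr)
    assume "\<not> eventually P F"
    then have "\<forall>\<^sub>F x in G. \<not> P x"
      using assms(3) by (auto simp: ultra_not[OF assms(1)] intro: filter_leD)
    with P have "eventually (\<lambda>_. False) G"
      by eventually_elim simp
    with assms(2) show False
      by (simp add: trivial_limit_def)
  qed
qed

lemma ultra_conv: "ultra F \<Longrightarrow> ultra G \<Longrightarrow> ultra (conv F G)"
  unfolding ultra_def[of "conv F G"]
  by (simp add: eventually_conv ultra_not conv_neq_bot ultra_def[THEN iffD1])

text \<open>Zorn's lemma for proper filters. Properness survives infima of chains, because the infimum of a
  chain is its union as a family of sets; so only \<open>\<Phi>\<close> has to be checked there.\<close>
lemma minimal_filter:
  fixes F :: "'a filter"
  assumes F: "\<Phi> F" "F \<noteq> bot"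
    and Inf: "\<And>C. \<lbrakk>C \<noteq> {}; \<And>G. G \<in> C \<Longrightarrow> \<Phi> G \<and> G \<noteq> bot;
                 \<And>P. eventually P (Inf C) \<longleftrightarrow> (\<exists>G\<in>C. eventually P G)\<rbrakk> \<Longrightarrow> \<Phi> (Inf C)"
  obtains G where "G \<le> F" "G \<noteq> bot" "\<Phi> G" "\<And>H. \<lbrakk>H \<le> G; H \<noteq> bot; \<Phi> H\<rbrakk> \<Longrightarrow> H = G"
proof -
  define A where "A = {G. G \<le> F \<and> G \<noteq> bot \<and> \<Phi> G}"
  have "\<exists>m\<in>A. \<forall>a\<in>A. m \<ge> a \<longrightarrow> a = m"
  proof (rule predicate_Zorn)
    show "partial_order_on A (relation_of (\<ge>) A)"
      by (rule partial_order_on_relation_ofI) auto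
    fix C assume C: "C \<in> Chains (relation_of (\<ge>) A)"
    show "\<exists>u\<in>A. \<forall>a\<in>C. u \<le> a"
    proof (cases "C = {}")
      case True
      then show ?thesis using F by (auto simp: A_def)
    next
      case False
      have CA: "C \<subseteq> A" and lin: "\<And>a b. a \<in> C \<Longrightarrow> b \<in> C \<Longrightarrow> a \<le> b \<or> b \<le> a"
        using C unfolding Chains_def relation_of_def by auto
      have ev: "eventually P (Inf C) \<longleftrightarrow> (\<exists>G\<in>C. eventually P G)" for P
      proof (rule eventually_Inf_base[OF False])
        fix a b assume "a \<in> C" "b \<in> C"
        with lin[of a b] show "\<exists>x\<in>C. x \<le> inf a b"
          by (auto simp: inf_absorb1 inf_absorb2)
      qed
      have "\<Phi> (Inf C)"
        using CA False ev by (intro Inf) (auto simp: A_def)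
      moreover have "Inf C \<noteq> bot"
        using CA unfolding trivial_limit_def ev by (auto simp: A_def trivial_limit_def)
      moreover have "Inf C \<le> F"
        using CA False by (auto simp: A_def intro: Inf_lower2)
      ultimately have "Inf C \<in> A" by (simp add: A_def)
      then show ?thesis
        by (intro bexI[of _ "Inf C"]) (auto intro: Inf_lower)
    qed
  qed
  then obtain m where m: "m \<in> A" "\<And>a. a \<in> A \<Longrightarrow> a \<le> m \<Longrightarrow> a = m"
    by blast
  show ?thesis
  proof (rule that[of m])
    fix H assume "H \<le> m" "H \<noteq> bot" "\<Phi> H"
    then show "H = m"
      using m order_trans[of H m F] by (simp add: A_def)
  qed (use m(1) in \<open>simp_all add: A_def\<close>)
qed

lemma ultra_exists:
  assumes "F \<noteq> bot"
  obtains u where "ultra u" "u \<le> F"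
proof -
  obtain u where u: "u \<le> F" "u \<noteq> bot" and min: "\<And>H. \<lbrakk>H \<le> u; H \<noteq> bot\<rbrakk> \<Longrightarrow> H = u"
    using minimal_filter[of "\<lambda>_. True" F] assms by metis
  have "eventually P u \<or> (\<forall>\<^sub>F x in u. \<not> P x)" for P
  proof (cases "inf u (principal {x. P x}) = bot")
    case True
    then show ?thesis
      by (auto simp: trivial_limit_def eventually_inf_principal)
  next
    case False
    then have "inf u (principal {x. P x}) = u"
      by (intro min) auto
    moreover have "eventually P (inf u (principal {x. P x}))"
      by (simp add: eventually_inf_principal)
    ultimately show ?thesis by simp
  qed
  with u that show ?thesis by (auto simp: ultra_def)
qed

text \<open>A compactness statement: the ultrafilters \<open>x \<cdot> e\<close> with \<open>x\<close> in the closed set \<open>F\<close> form the whole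
  closed set \<open>conv F e\<close>, since right multiplication by \<open>e\<close> is continuous. The sets \<open>B P\<close>, for \<open>P\<close> in
  \<open>f\<close>, express \<open>x \<cdot> e \<le> f\<close>, and as \<open>e\<close> is an ultrafilter no set of \<open>F\<close> can miss one of them.\<close>
lemma conv_factor:
  assumes f: "f \<le> conv F e" "f \<noteq> bot" and e: "ultra e"
  obtains x where "x \<le> F" "x \<noteq> bot" "conv x e \<le> f"
proof
  define B where "B = (\<lambda>P. {x. \<forall>\<^sub>F y in e. P (x @ y)})"
  define K where "K = (INF P\<in>{P. eventually P f}. principal (B P))"
  have K: "eventually Q K \<longleftrightarrow> (\<exists>P. eventually P f \<and> (\<forall>x\<in>B P. Q x))" for Q
    unfolding K_def
  proof (subst eventually_INF_base)
    fix P P' assume "P \<in> {P. eventually P f}" "P' \<in> {P. eventually P f}"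
    then show "\<exists>R\<in>{P. eventually P f}.
        principal (B R) \<le> inf (principal (B P)) (principal (B P'))"
      by (intro bexI[of _ "\<lambda>x. P x \<and> P' x"])
         (auto simp: B_def eventually_conj elim: eventually_mono)
  qed (auto simp: eventually_principal intro!: exI[of _ "\<lambda>_. True"])
  show "inf F K \<le> F" by simp
  show "conv (inf F K) e \<le> f"
  proof (rule filter_leI)
    fix P assume "eventually P f"
    then have "\<forall>\<^sub>F x in K. x \<in> B P"
      unfolding K by blast
    then have "\<forall>\<^sub>F x in inf F K. x \<in> B P"
      by (rule filter_leD[rotated]) simp
    then show "eventually P (conv (inf F K) e)"
      by (simp add: eventually_conv B_def)
  qed
  show "inf F K \<noteq> bot"
  proof
    assume "inf F K = bot"
    then obtain Q P where Q: "eventually Q F" and P: "eventually P f"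
      and disj: "\<And>x. Q x \<Longrightarrow> x \<notin> B P"
      unfolding trivial_limit_def eventually_inf K by blast
    from Q have "\<forall>\<^sub>F x in F. \<forall>\<^sub>F y in e. \<not> P (x @ y)"
    proof eventually_elim
      case (elim x)
      from disj[OF this] show ?case
        by (simp add: B_def ultra_not[OF e])
    qed
    then have "\<forall>\<^sub>F x in f. \<not> P x"
      using filter_leD[OF f(1)] by (simp add: eventually_conv)
    with P have "eventually (\<lambda>_. False) f"
      by eventually_elim simp
    with f(2) show False by (simp add: trivial_limit_def)
  qed
qed

text \<open>The lemma of Ellis and Numakura: every closed subsemigroup contains an idempotent. In a minimal
  closed subsemigroup \<open>G\<close> with an element \<open>u\<close>, both \<open>G \<cdot> u\<close> and \<open>{x \<in> G. x \<cdot> u = u}\<close> are closed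
  subsemigroups of \<open>G\<close>, hence equal to \<open>G\<close>.\<close>
theorem idempotent_ultrafilter:
  assumes F: "F \<noteq> bot" "conv F F \<le> F"
  obtains u where "ultra u" "u \<le> F" "conv u u = u"
proof -
  obtain G where G: "G \<le> F" "G \<noteq> bot" "conv G G \<le> G"
    and min: "\<And>H. \<lbrakk>H \<le> G; H \<noteq> bot; conv H H \<le> H\<rbrakk> \<Longrightarrow> H = G"
  proof (rule minimal_filter[of "\<lambda>F. conv F F \<le> F" F])
    fix C :: "'a list filter set"
    assume C: "\<And>G. G \<in> C \<Longrightarrow> conv G G \<le> G \<and> G \<noteq> bot"
      and ev: "\<And>P. eventually P (Inf C) \<longleftrightarrow> (\<exists>G\<in>C. eventually P G)"
    show "conv (Inf C) (Inf C) \<le> Inf C"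
    proof (rule Inf_greatest)
      fix G assume "G \<in> C"
      then show "conv (Inf C) (Inf C) \<le> G"
        using C by (meson Inf_lower conv_mono order_trans)
    qed
  qed (use F in auto)
  obtain u where u: "ultra u" "u \<le> G"
    using ultra_exists G(2) by blast
  then have "u \<noteq> bot" by (simp add: ultra_def)
  have Gu: "conv G u = G"
  proof (rule min)
    show le: "conv G u \<le> G"
      using conv_mono[OF order_refl u(2)] G(3) by (rule order_trans)
    have "conv (conv G u) (conv G u) \<le> conv G (conv G u)"
      by (rule conv_mono[OF le order_refl])
    also have "\<dots> \<le> conv G u"
      unfolding conv_assoc[symmetric] by (rule conv_mono[OF G(3) order_refl])
    finally show "conv (conv G u) (conv G u) \<le> conv G u" .
  qed (use G(2) \<open>u \<noteq> bot\<close> in \<open>simp add: conv_neq_bot\<close>)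
  \<comment> \<open>the closed set of all \<open>x\<close> with \<open>x \<cdot> u = u\<close>\<close>
  define K where "K = Sup {x. conv x u \<le> u}"
  have Ku: "conv K u \<le> u"
    by (auto simp: K_def le_filter_def eventually_Sup eventually_conv)
  have "inf G K = G"
  proof (rule min)
    obtain x where "x \<le> G" "x \<noteq> bot" "conv x u \<le> u"
      using conv_factor[of u G u] u \<open>u \<noteq> bot\<close> by (metis Gu)
    then have "x \<le> inf G K" by (auto simp: K_def intro: Sup_upper)
    with \<open>x \<noteq> bot\<close> show "inf G K \<noteq> bot" by (metis bot.extremum_uniqueI)
    have "conv (conv (inf G K) (inf G K)) u \<le> conv K (conv K u)"
      unfolding conv_assoc by (intro conv_mono) auto
    also have "\<dots> \<le> u"
      using conv_mono[OF order_refl Ku] Ku by (rule order_trans)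
    finally have "conv (inf G K) (inf G K) \<le> K"
      by (auto simp: K_def intro: Sup_upper)
    moreover have "conv (inf G K) (inf G K) \<le> G"
      using conv_mono[of "inf G K" G "inf G K" G] G(3) by auto
    ultimately show "conv (inf G K) (inf G K) \<le> inf G K" by simp
  qed simp
  then have "u \<le> K" using u(2) by (metis inf.cobounded2 order_trans)
  then have "conv u u \<le> u"
    using conv_mono[OF _ order_refl] Ku by (metis order_trans)
  then have "conv u u = u"
    using ultra_eqI[OF u(1)] conv_neq_bot \<open>u \<noteq> bot\<close> by blast
  with u G(1) that show ?thesis by (meson order_trans)
qed

section \<open>Gowers' theorem for words under truncated subtraction\<close>

definition words_of_max :: "nat \<Rightarrow> nat list set" where
  "words_of_max k = {w. k \<in> set w \<and> (\<forall>a\<in>set w. a \<le> k)}"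

abbreviation lower :: "nat \<Rightarrow> nat list \<Rightarrow> nat list" where
  "lower d \<equiv> map (\<lambda>a. a - d)"

lemma append_words_of_max:
  "\<lbrakk>x \<in> words_of_max j; y \<in> words_of_max k\<rbrakk> \<Longrightarrow> x @ y \<in> words_of_max (max j k)"
  by (fastforce simp: words_of_max_def max_def)

lemma conv_le_words_of_max:
  assumes "F \<le> principal (words_of_max j)" "G \<le> principal (words_of_max k)" "l = max j k"
  shows "conv F G \<le> principal (words_of_max l)"
  using assms append_words_of_max
  by (auto simp: le_principal eventually_conv elim!: eventually_mono)

text \<open>Gowers' ultrafilter. It is built by induction on \<open>k\<close>, with the idempotent \<open>e\<close> for \<open>k\<close> as the image
  of the new one under \<open>lower 1\<close>. The closed set \<open>F\<close> of all ultrafilters that lower to \<open>e\<close> and live on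
  the words of maximum \<open>k + 1\<close> is not empty, since adding \<open>1\<close> to all letters inverts \<open>lower 1\<close>. Now
  \<open>F \<cdot> e\<close> is a closed subsemigroup; an idempotent \<open>f\<close> of it satisfies \<open>f \<cdot> e = f\<close> and lowers to \<open>e\<close>, and
  \<open>e \<cdot> f\<close> absorbs \<open>e\<close> on both sides. That \<open>e\<close> absorbs \<open>filtermap (lower 1) e\<close> on the right as well is
  what makes \<open>f\<close> lower to \<open>e\<close> in the next step.\<close>
theorem gowers_ultrafilter:
  obtains e where "ultra e" "e \<le> principal (words_of_max k)"
    "\<And>d. conv (filtermap (lower d) e) e = e"
proof -
  have "\<exists>e. ultra e \<and> e \<le> principal (words_of_max k) \<and>
      (\<forall>d. conv (filtermap (lower d) e) e = e) \<and> conv e (filtermap (lower 1) e) = e"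
  proof (induction k)
    case 0
    have "[0] \<in> words_of_max 0" by (simp add: words_of_max_def)
    then have "principal (words_of_max 0) \<noteq> bot"
      by (auto simp: principal_eq_bot_iff)
    moreover have "conv (principal (words_of_max 0)) (principal (words_of_max 0))
        \<le> principal (words_of_max 0)"
      by (rule conv_le_words_of_max) auto
    ultimately obtain e where e: "ultra e" "e \<le> principal (words_of_max 0)" "conv e e = e"
      using idempotent_ultrafilter by blast
    have "filtermap (lower d) e = e" for d
    proof -
      have "lower d w = w" if "w \<in> words_of_max 0" for w
        by (rule map_idI) (use that in \<open>auto simp: words_of_max_def\<close>)
      with e(2) have "\<forall>\<^sub>F w in e. lower d w = w"
        unfolding le_principal by (rule eventually_mono)
      then have "eventually (\<lambda>w. P (lower d w)) e \<longleftrightarrow> eventually P e" for P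
        by (rule eventually_cong) simp
      then show ?thesis by (simp add: filter_eq_iff eventually_filtermap)
    qed
    with e show ?case by (intro exI[of _ e]) simp
  next
    case (Suc k)
    then obtain e where e: "ultra e" "e \<le> principal (words_of_max k)"
      and absorb: "\<And>d. conv (filtermap (lower d) e) e = e"
      and right: "conv e (filtermap (lower 1) e) = e" by blast
    define T where "T = filtermap (lower 1)"
    have T_conv: "T (conv F G) = conv (T F) (T G)" for F G
      unfolding T_def by (rule filtermap_conv)
    have T_mono: "F \<le> G \<Longrightarrow> T F \<le> T G" for F G
      unfolding T_def by (rule filtermap_mono)
    have lower_0: "filtermap (lower 0) F = F" for F :: "nat list filter"
      by (simp add: filtermap_ident)
    have ee: "conv e e = e" using absorb[of 0] by (simp add: lower_0)
    have Te: "conv (T e) e = e" "conv e (T e) = e"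
      using absorb[of 1] right by (simp_all add: T_def)
    define F where "F = inf (filtercomap (lower 1) e) (principal (words_of_max (Suc k)))"
    have F_iff: "G \<le> F \<longleftrightarrow> T G \<le> e \<and> G \<le> principal (words_of_max (Suc k))" for G
      by (simp add: F_def T_def filtermap_le_iff_le_filtercomap)
    have "filtermap (map Suc) e \<le> F"
      unfolding F_iff
    proof
      show "T (filtermap (map Suc) e) \<le> e"
        by (simp add: T_def filtermap_filtermap comp_def filtermap_ident)
      have "map Suc w \<in> words_of_max (Suc k)" if "w \<in> words_of_max k" for w
        using that by (auto simp: words_of_max_def)
      with e(2) show "filtermap (map Suc) e \<le> principal (words_of_max (Suc k))"
        by (auto simp: le_principal eventually_filtermap elim!: eventually_mono)
    qed
    moreover have "filtermap (map Suc) e \<noteq> bot"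
      using e(1) by (simp add: filtermap_bot_iff ultra_def)
    ultimately have "F \<noteq> bot" by (metis bot.extremum_uniqueI)
    have e_bot: "e \<noteq> bot" using e(1) by (simp add: ultra_def)
    have TF: "T F \<le> e" and F_words: "F \<le> principal (words_of_max (Suc k))"
      using F_iff[of F] by simp_all
    \<comment> \<open>this makes \<open>F \<cdot> e\<close> a subsemigroup, as \<open>F \<cdot> e \<cdot> F \<cdot> e \<le> F \<cdot> e\<close>\<close>
    have "conv F (conv e F) \<le> F"
      unfolding F_iff
    proof
      have "T (conv F (conv e F)) \<le> conv e (conv (T e) e)"
        unfolding T_conv by (intro conv_mono TF order_refl)
      then show "T (conv F (conv e F)) \<le> e" by (simp add: Te ee)
      show "conv F (conv e F) \<le> principal (words_of_max (Suc k))"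
        by (rule conv_le_words_of_max[OF F_words conv_le_words_of_max[OF e(2) F_words refl]]) simp
    qed
    then have "conv (conv F (conv e F)) e \<le> conv F e"
      by (intro conv_mono order_refl)
    then have "conv (conv F e) (conv F e) \<le> conv F e"
      by (simp add: conv_assoc)
    then obtain f where f: "ultra f" "f \<le> conv F e" "conv f f = f"
      using idempotent_ultrafilter conv_neq_bot[OF \<open>F \<noteq> bot\<close> e_bot] by blast
    then have f_bot: "f \<noteq> bot" by (simp add: ultra_def)
    obtain x where x: "x \<le> F" "x \<noteq> bot" "conv x e \<le> f"
      using conv_factor[OF f(2) f_bot e(1)] .
    have xe: "conv x e = f"
      using ultra_eqI[OF f(1) conv_neq_bot[OF x(2) e_bot] x(3)] .
    have fe: "conv f e = f"
      using xe by (metis conv_assoc ee)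
    have "T x \<le> e" using x(1) F_iff by simp
    moreover have "T x \<noteq> bot" using x(2) by (simp add: T_def filtermap_bot_iff)
    ultimately have Tx: "T x = e" using ultra_eqI[OF e(1)] by simp
    have Tf: "T f = e"
      unfolding xe[symmetric] T_conv Tx Te ..
    have f_words: "f \<le> principal (words_of_max (Suc k))"
      by (rule order_trans[OF f(2) conv_le_words_of_max[OF F_words e(2)]]) simp
    define g where "g = conv e f"
    have Tg: "T g = e" by (simp add: g_def T_conv Tf Te)
    have eg: "conv e g = g" by (simp add: g_def conv_assoc[symmetric] ee)
    have ge: "conv g e = g" by (simp add: g_def conv_assoc fe)
    have gg: "conv g g = g"
      by (metis g_def conv_assoc fe f(3))
    have "conv (filtermap (lower d) g) g = g" for d
    proof (cases d)
      case 0
      then show ?thesis by (simp add: lower_0 gg)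
    next
      case (Suc d')
      have "filtermap (lower d) g = filtermap (lower d') (T g)"
        by (simp add: T_def filtermap_filtermap Suc comp_def)
      then have "conv (filtermap (lower d) g) g = conv (conv (filtermap (lower d') e) e) g"
        by (simp add: Tg conv_assoc eg)
      then show ?thesis by (simp add: absorb eg)
    qed
    moreover have "conv g (filtermap (lower 1) g) = g"
      using ge Tg by (simp add: T_def)
    moreover have "ultra g" unfolding g_def by (rule ultra_conv[OF e(1) f(1)])
    moreover have "g \<le> principal (words_of_max (Suc k))"
      unfolding g_def by (rule conv_le_words_of_max[OF e(2) f_words]) simp
    ultimately show ?case by blast
  qed
  then show ?thesis using that by blast
qed

text \<open>Every letter carries the index of the block that it comes from, so that shifting each block by
  its own amount is a single \<^const>\<open>map\<close>.\<close>
definition blocks :: "(nat \<Rightarrow> 'a list) \<Rightarrow> nat \<Rightarrow> ('a \<times> nat) list" where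
  "blocks x n = concat (map (\<lambda>i. map (\<lambda>a. (a, i)) (x i)) [0..<Suc n])"

text \<open>The blocks are chosen one by one, each typical for \<open>e\<close>. A word \<open>s\<close> is good if \<open>s @ y\<close> has the right
  colour for \<open>e\<close>-almost all \<open>y\<close>. If \<open>s\<close> is good, then so is \<open>s @ lower d x\<close> for \<open>e\<close>-almost all \<open>x\<close>, because
  lowering \<open>e\<close> and multiplying by \<open>e\<close> gives \<open>e\<close> again. Letters are at most \<open>p\<close>, so only finitely many
  words \<open>s\<close> have to be respected at every step.\<close>
theorem gowers_shifted_words:
  fixes col :: "nat list \<Rightarrow> nat"
  assumes col: "\<And>w. w \<in> words_of_max p \<Longrightarrow> col w < k"
  shows "\<exists>c<k. \<exists>x. (\<forall>n. x n \<in> words_of_max p) \<and>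
    (\<forall>n s. s n = 0 \<longrightarrow> col (map (\<lambda>(a, i). a - s i) (blocks x n)) = c)"
proof -
  obtain e where e: "ultra e" "e \<le> principal (words_of_max p)"
    and absorb: "\<And>d. conv (filtermap (lower d) e) e = e"
    using gowers_ultrafilter by blast
  have words: "\<forall>\<^sub>F w in e. w \<in> words_of_max p"
    using e(2) by (simp add: le_principal)
  have "\<exists>c<k. \<forall>\<^sub>F w in e. col w = c"
  proof (rule ccontr)
    assume "\<not> ?thesis"
    then have "\<forall>c\<in>{..<k}. \<forall>\<^sub>F w in e. col w \<noteq> c"
      using ultra_not[OF e(1)] by auto
    then have "\<forall>\<^sub>F w in e. \<forall>c\<in>{..<k}. col w \<noteq> c"
      by (simp add: eventually_ball_finite)
    with words have "eventually (\<lambda>_. False) e"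
      by eventually_elim (use col in auto)
    with e(1) show False by (simp add: ultra_def trivial_limit_def)
  qed
  then obtain c where c: "c < k" "\<forall>\<^sub>F w in e. col w = c" by blast
  define good where "good s \<longleftrightarrow> (\<forall>\<^sub>F y in e. col (s @ y) = c)" for s
  \<comment> \<open>\<open>S\<close> holds all shifted concatenations of the blocks before \<open>x\<close>\<close>
  define P where "P = (\<lambda>(n::nat) (S, x). finite S \<and> (\<forall>s\<in>S. good s) \<and> x \<in> words_of_max p \<and>
      (\<forall>s\<in>S. col (s @ x) = c) \<and> (\<forall>s\<in>S. \<forall>d\<le>p. good (s @ lower d x)))"
  define Q where "Q = (\<lambda>(n::nat) (S, x) (S', x' :: nat list).
      S' = (\<lambda>(s, d). s @ lower d x) ` (S \<times> {..p}))"
  have next_block: "\<exists>x. P n (S, x)" if S: "finite S" "\<And>s. s \<in> S \<Longrightarrow> good s" for n S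
  proof -
    have *: "\<forall>\<^sub>F x in e. good (s @ lower d x)" if "s \<in> S" for s d
    proof -
      have "\<forall>\<^sub>F y in conv (filtermap (lower d) e) e. col (s @ y) = c"
        using S(2)[OF that] by (simp add: absorb good_def)
      then show ?thesis
        by (simp add: eventually_conv eventually_filtermap good_def)
    qed
    have "\<forall>\<^sub>F x in e. x \<in> words_of_max p \<and> (\<forall>s\<in>S. col (s @ x) = c) \<and>
        (\<forall>s\<in>S. \<forall>d\<in>{..p}. good (s @ lower d x))"
    proof (intro eventually_conj words)
      show "\<forall>\<^sub>F x in e. \<forall>s\<in>S. col (s @ x) = c"
        by (rule eventually_ball_finite[OF S(1)]) (use S(2) good_def in blast)
      show "\<forall>\<^sub>F x in e. \<forall>s\<in>S. \<forall>d\<in>{..p}. good (s @ lower d x)"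
        using * by (intro eventually_ball_finite S(1) ballI) auto
    qed
    moreover have "e \<noteq> bot" using e(1) by (simp add: ultra_def)
    ultimately have "\<exists>x. x \<in> words_of_max p \<and> (\<forall>s\<in>S. col (s @ x) = c) \<and>
        (\<forall>s\<in>S. \<forall>d\<in>{..p}. good (s @ lower d x))"
      by (intro eventually_happens'[of e])
    then obtain x where "x \<in> words_of_max p \<and> (\<forall>s\<in>S. col (s @ x) = c) \<and>
        (\<forall>s\<in>S. \<forall>d\<in>{..p}. good (s @ lower d x))" ..
    with S show ?thesis unfolding P_def by auto
  qed
  have "\<exists>f. \<forall>n. (P n (f n) \<and> (n = 0 \<longrightarrow> fst (f n) = {[]})) \<and> Q n (f n) (f (Suc n))"
  proof (rule dependent_nat_choice)
    obtain x where "P 0 ({[]}, x)"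
      using next_block[of "{[]}" 0] c(2) by (auto simp: good_def)
    then show "\<exists>Sx. P 0 Sx \<and> ((0::nat) = 0 \<longrightarrow> fst Sx = {[]})"
      by auto
  next
    fix Sx n assume Sx: "P n Sx \<and> (n = 0 \<longrightarrow> fst Sx = {[]})"
    obtain S x where [simp]: "Sx = (S, x)" by (cases Sx)
    let ?S = "(\<lambda>(s, d). s @ lower d x) ` (S \<times> {..p})"
    have "finite ?S" "\<And>s. s \<in> ?S \<Longrightarrow> good s"
      using Sx by (auto simp: P_def)
    then obtain x' where "P (Suc n) (?S, x')"
      using next_block by blast
    then show "\<exists>y. (P (Suc n) y \<and> (Suc n = 0 \<longrightarrow> fst y = {[]})) \<and> Q n Sx y"
      by (intro exI[of _ "(?S, x')"]) (auto simp: Q_def)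
  qed
  then obtain f where f: "\<And>n. P n (f n)" "fst (f 0) = {[]}" "\<And>n. Q n (f n) (f (Suc n))"
    by auto
  define x where "x n = snd (f n)" for n
  have x: "x n \<in> words_of_max p" for n
    using f(1)[of n] by (auto simp: P_def x_def split: prod.splits)
  have step: "fst (f (Suc n)) = (\<lambda>(s, d). s @ lower d (x n)) ` (fst (f n) \<times> {..p})" for n
    using f(3)[of n] by (auto simp: Q_def x_def split: prod.splits)
  have prefix: "concat (map (\<lambda>i. lower (s i) (x i)) [0..<n]) \<in> fst (f n)" for n s
  proof (induction n)
    case (Suc n)
    have "lower (s n) (x n) = lower (min p (s n)) (x n)"
      using x[of n] by (auto simp: words_of_max_def)
    with Suc show ?case
      unfolding step by (auto intro!: image_eqI[where x = "(_, min p (s n))"])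
  qed (simp add: f(2))
  have split: "map (\<lambda>(a, i). a - s i) (blocks x n) =
      concat (map (\<lambda>i. lower (s i) (x i)) [0..<n]) @ x n" if "s n = 0" for s n
    using that by (simp add: blocks_def map_concat comp_def)
  have "col (map (\<lambda>(a, i). a - s i) (blocks x n)) = c" if "s n = 0" for n s
    using f(1)[of n] prefix[of s n] unfolding split[of s n, OF that]
    by (auto simp: P_def x_def split: prod.splits)
  with c(1) x show ?thesis by blast
qed

section \<open>A metric on words of distances\<close>

text \<open>The padding letter is the largest distance, so that no witness in \<open>near\<close> below \<open>2\<close> can lie beyond
  the end of a word.\<close>
definition letter :: "real list \<Rightarrow> nat \<Rightarrow> real" where
  "letter v l = (if l < length v then v ! l else 2)"

text \<open>The letter \<open>0\<close> is what makes the distance of a word from itself vanish.\<close>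
definition distance_words :: "real list set" where
  "distance_words = {v. set v \<subseteq> {0..2} \<and> 0 \<in> set v}"

text \<open>The witness \<open>l\<close> is a landmark that is close to both words, and the earlier landmarks do not
  contradict a distance of at most \<open>r\<close>. Landmarks after \<open>l\<close> are ignored: a short word says nothing about
  them.\<close>
definition near :: "real \<Rightarrow> real list \<Rightarrow> real list \<Rightarrow> bool" where
  "near r v w \<longleftrightarrow> 2 \<le> r \<or>
     (\<exists>l. letter v l + letter w l \<le> r \<and> (\<forall>i<l. \<bar>letter v i - letter w i\<bar> \<le> r))"

definition word_dist :: "real list \<Rightarrow> real list \<Rightarrow> real" where
  "word_dist v w = Inf {r. 0 \<le> r \<and> near r v w}"

lemma letter_nonneg: "v \<in> distance_words \<Longrightarrow> 0 \<le> letter v l"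
  using nth_mem[of l v] by (auto simp: letter_def distance_words_def simp del: nth_mem)

lemma near_commute: "near r v w \<longleftrightarrow> near r w v"
  by (simp add: near_def add.commute abs_minus_commute)

text \<open>The smaller witness works. If it is the one for \<open>u\<close> and \<open>v\<close>, then \<open>letter u k + letter v k \<le> r\<close> there,
  and \<open>v\<close> may be replaced by \<open>w\<close> at the cost of \<open>s\<close>; the other case is symmetric.\<close>
lemma near_triangle:
  assumes "v \<in> distance_words" "0 \<le> r" "0 \<le> s" "near r u v" "near s v w"
  shows "near (r + s) u w"
proof (cases "2 \<le> r \<or> 2 \<le> s")
  case True
  with assms(2,3) show ?thesis by (auto simp: near_def)
next
  case False
  then obtain k l where
    k: "letter u k + letter v k \<le> r" "\<And>i. i < k \<Longrightarrow> \<bar>letter u i - letter v i\<bar> \<le> r" and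
    l: "letter v l + letter w l \<le> s" "\<And>i. i < l \<Longrightarrow> \<bar>letter v i - letter w i\<bar> \<le> s"
    using assms(4,5) by (auto simp: near_def)
  define m where "m = min k l"
  have "letter u m + letter w m \<le> r + s"
  proof (cases k l rule: linorder_cases)
    case less
    with k(1) l(2)[of k] show ?thesis by (simp add: m_def)
  next
    case equal
    with k(1) l(1) letter_nonneg[OF assms(1), of k] show ?thesis by (simp add: m_def)
  next
    case greater
    with l(1) k(2)[of l] show ?thesis by (simp add: m_def)
  qed
  moreover have "\<bar>letter u i - letter w i\<bar> \<le> r + s" if "i < m" for i
    using k(2)[of i] l(2)[of i] that by (simp add: m_def)
  ultimately show ?thesis by (auto simp: near_def)
qed

lemma word_dist_le: "0 \<le> r \<Longrightarrow> near r v w \<Longrightarrow> word_dist v w \<le> r"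
  unfolding word_dist_def by (rule cInf_lower) (auto intro: bdd_belowI[of _ 0])

lemma word_dist_ge:
  assumes "\<And>r. 0 \<le> r \<Longrightarrow> near r v w \<Longrightarrow> a \<le> r"
  shows "a \<le> word_dist v w"
  unfolding word_dist_def
  by (rule cInf_greatest) (use assms in \<open>auto simp: near_def intro!: exI[of _ 2]\<close>)

lemma word_dist_nonneg: "0 \<le> word_dist v w"
  by (rule word_dist_ge)

lemma word_dist_le_2: "word_dist v w \<le> 2"
  by (rule word_dist_le) (auto simp: near_def)

lemma word_dist_commute: "word_dist v w = word_dist w v"
  by (simp add: word_dist_def near_commute)

lemma word_dist_self:
  assumes "v \<in> distance_words"
  shows "word_dist v v = 0"
proof (rule antisym[OF word_dist_le word_dist_nonneg])
  obtain l where "l < length v" "v ! l = 0"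
    using assms by (auto simp: distance_words_def in_set_conv_nth)
  then show "near 0 v v"
    by (auto simp: near_def letter_def intro!: exI[of _ l])
qed simp

lemma word_dist_triangle:
  assumes "v \<in> distance_words"
  shows "word_dist u w \<le> word_dist u v + word_dist v w"
proof -
  have "word_dist u w - s \<le> word_dist u v" if s: "0 \<le> s" "near s v w" for s
  proof (rule word_dist_ge)
    fix r assume "0 \<le> r" "near r u v"
    with s assms have "word_dist u w \<le> r + s"
      by (intro word_dist_le near_triangle) auto
    then show "word_dist u w - s \<le> r" by simp
  qed
  then have "word_dist u w - word_dist u v \<le> word_dist v w"
    by (intro word_dist_ge) (auto simp: algebra_simps)
  then show ?thesis by simp
qed

text \<open>Distinct words can have distance \<open>0\<close>, for instance if they agree up to their first letter \<open>0\<close>.\<close>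
definition pseudometric_on :: "'a set \<Rightarrow> ('a \<Rightarrow> 'a \<Rightarrow> real) \<Rightarrow> bool" where
  "pseudometric_on A d \<longleftrightarrow> (\<forall>x\<in>A. d x x = 0) \<and> (\<forall>x\<in>A. \<forall>y\<in>A. d x y = d y x) \<and>
     (\<forall>x\<in>A. \<forall>y\<in>A. \<forall>z\<in>A. d x z \<le> d x y + d y z)"

lemma pseudometric_on_nonneg:
  "pseudometric_on A d \<Longrightarrow> x \<in> A \<Longrightarrow> y \<in> A \<Longrightarrow> 0 \<le> d x y"
  unfolding pseudometric_on_def by (smt (verit))

lemma pseudometric_on_word_dist: "pseudometric_on distance_words word_dist"
  by (auto simp: pseudometric_on_def word_dist_self word_dist_triangle intro: word_dist_commute)

text \<open>The code of point \<open>n\<close> if \<open>s i\<close> is its distance to point \<open>i\<close>; in particular \<open>s n\<close> should be \<open>0\<close>.\<close>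
definition code :: "(nat \<Rightarrow> real list) \<Rightarrow> (nat \<Rightarrow> real) \<Rightarrow> nat \<Rightarrow> real list" where
  "code x s n = map (\<lambda>(a, i). min 2 (a + s i)) (blocks x n)"

lemma set_blocks: "set (blocks x n) = {(a, i). i \<le> n \<and> a \<in> set (x i)}"
  by (force simp: blocks_def simp del: upt_Suc)

lemma blocks_prefix:
  assumes "m \<le> n"
  obtains z where "blocks x n = blocks x m @ z"
proof -
  have "[0..<Suc n] = [0..<Suc m] @ [Suc m..<Suc n]"
    using upt_add_eq_append[of 0 "Suc m" "n - m"] assms by (simp del: upt_Suc)
  then show ?thesis using that by (simp add: blocks_def del: upt_Suc)
qed

lemma letter_code:
  assumes "m \<le> n" "l < length (blocks x m)"
  shows "letter (code x s n) l = (case blocks x m ! l of (a, i) \<Rightarrow> min 2 (a + s i))"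
proof -
  obtain z where z: "blocks x n = blocks x m @ z" using blocks_prefix assms(1) .
  show ?thesis using assms(2) by (simp add: letter_def code_def z nth_append)
qed

lemma code_in_distance_words:
  assumes "\<And>i. x i \<in> distance_words" "\<And>i. 0 \<le> s i" "s n = 0"
  shows "code x s n \<in> distance_words"
proof -
  have "0 \<in> set (code x s n)"
    using assms(1)[of n] assms(3)
    by (force simp: code_def set_blocks distance_words_def intro!: image_eqI[of _ _ "(0, n)"])
  moreover have "set (code x s n) \<subseteq> {0..2}"
  proof -
    have "0 \<le> a + s i" if "a \<in> set (x i)" for a i
      using assms(1)[of i] assms(2)[of i] that by (force simp: distance_words_def)
    then show ?thesis by (auto simp: code_def set_blocks)
  qed
  ultimately show ?thesis by (simp add: distance_words_def)
qed

text \<open>The witness is a letter \<open>0\<close> in block \<open>m\<close>. Up to there both words are built from the same blocks, so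
  corresponding letters differ by no more than the shifts. The case \<open>m < n\<close> compares two points of a
  space, the case \<open>m = n\<close> two codes for the same point.\<close>
lemma near_code:
  assumes mn: "m \<le> n" and x: "x m \<in> distance_words"
    and s: "s m = 0" and t: "0 \<le> t m" "t m \<le> r"
    and close: "\<And>i. i \<le> m \<Longrightarrow> \<bar>s i - t i\<bar> \<le> r"
  shows "near r (code x s m) (code x t n)"
proof -
  have "(0, m) \<in> set (blocks x m)"
    using x by (simp add: set_blocks distance_words_def)
  then obtain l where l: "l < length (blocks x m)" "blocks x m ! l = (0, m)"
    by (auto simp: in_set_conv_nth)
  have "\<bar>letter (code x s m) k - letter (code x t n) k\<bar> \<le> r" if "k < l" for k
  proof -
    obtain a i where ai: "blocks x m ! k = (a, i)" by fastforce
    then have "i \<le> m"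
      using that l(1) nth_mem[of k "blocks x m"] by (auto simp: set_blocks)
    then show ?thesis
      using close[of i] that l(1) mn by (simp add: letter_code[of m] ai)
  qed
  moreover have "letter (code x s m) l + letter (code x t n) l \<le> r"
    using l mn s t by (simp add: letter_code[of m])
  ultimately show ?thesis by (auto simp: near_def)
qed

text \<open>For the lower bound, a witness \<open>k\<close> beyond the letter \<open>0\<close> of block \<open>m\<close> has to respect the difference
  at that letter, which is \<open>d m n\<close>. An earlier witness lies in some block \<open>i \<le> m\<close>, where the sum of the two
  letters is at least \<open>d m i + d n i\<close>, or else one of the letters is \<open>2\<close>.\<close>
theorem word_dist_code:
  assumes x: "\<And>i. x i \<in> distance_words"
    and d: "pseudometric_on UNIV d" "\<And>i j. d i j \<le> 2"
  shows "word_dist (code x (d m) m) (code x (d n) n) = d m n"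
proof -
  have refl: "d i i = 0" and sym: "d i j = d j i" and tri: "d i k \<le> d i j + d j k" for i j k
    using d(1) by (auto simp: pseudometric_on_def)
  have nonneg: "0 \<le> d i j" for i j
    using pseudometric_on_nonneg[OF d(1)] by simp
  have *: "word_dist (code x (d m) m) (code x (d n) n) = d m n" if mn: "m \<le> n" for m n
  proof (rule antisym)
    show "word_dist (code x (d m) m) (code x (d n) n) \<le> d m n"
    proof (intro word_dist_le nonneg near_code mn x refl)
      show "\<bar>d m i - d n i\<bar> \<le> d m n" for i
        using tri[of m i n] tri[of n i m] sym[of m n] by linarith
    qed (simp_all add: sym[of n m] nonneg)
  next
    show "d m n \<le> word_dist (code x (d m) m) (code x (d n) n)"
    proof (rule word_dist_ge)
      fix r assume "0 \<le> r" "near r (code x (d m) m) (code x (d n) n)"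
      then consider "2 \<le> r" | k where
        "letter (code x (d m) m) k + letter (code x (d n) n) k \<le> r"
        "\<And>i. i < k \<Longrightarrow> \<bar>letter (code x (d m) m) i - letter (code x (d n) n) i\<bar> \<le> r"
        unfolding near_def by blast
      then show "d m n \<le> r"
      proof cases
        case 1
        with d(2)[of m n] show ?thesis by simp
      next
        case 2
        have "(0, m) \<in> set (blocks x m)"
          using x[of m] by (simp add: set_blocks distance_words_def)
        then obtain l where l: "l < length (blocks x m)" "blocks x m ! l = (0, m)"
          by (auto simp: in_set_conv_nth)
        show ?thesis
        proof (cases "l < k")
          case True
          from 2(2)[OF this] show ?thesis
            using l mn d(2)[of n m] nonneg[of n m]
            by (simp add: letter_code[of m] refl sym[of m n])
        next
          case False
          with l(1) have k: "k < length (blocks x m)" by simp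
          obtain a i where ai: "blocks x m ! k = (a, i)" by fastforce
          then have "a \<in> set (x i)"
            using k nth_mem[of k "blocks x m"] by (auto simp: set_blocks)
          then have "0 \<le> a" using x[of i] by (auto simp: distance_words_def)
          then show ?thesis
            using 2(1) k mn tri[of m n i] sym[of i n] d(2)[of m n] nonneg[of m i] nonneg[of n i]
            by (simp add: letter_code[of m] ai min_def split: if_splits)
        qed
      qed
    qed
  qed
  show ?thesis
  proof (cases "m \<le> n")
    case False
    then show ?thesis
      using *[of n m] by (simp add: word_dist_commute[of "code x (d m) m"] sym[of m n])
  qed (rule *)
qed

lemma blocks_map: "blocks (\<lambda>i. map h (x i)) n = map (\<lambda>(a, i). (h a, i)) (blocks x n)"
  by (simp add: blocks_def map_concat comp_def)

text \<open>The colouring theorem in metric form. The alphabet \<open>R\<close> has to be fixed before the colouring is given,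
  and it has to be countable; so it contains every grid distance raised by every value of \<open>d\<close>, which is
  all that the words \<open>y n\<close> can use. Grid letters themselves belong to it because \<open>d\<close> takes the value \<open>0\<close>.\<close>
theorem words_near_one_colour:
  fixes d :: "nat \<Rightarrow> nat \<Rightarrow> real" and p :: nat
  assumes d: "pseudometric_on UNIV d" "\<And>i j. d i j \<le> 2" and p: "p > 0"
  shows "\<exists>A. countable A \<and> A \<subseteq> distance_words \<and>
    (\<forall>col (k::nat). (\<forall>w\<in>A. col w < k) \<longrightarrow>
       (\<exists>c<k. \<exists>y z. \<forall>n. y n \<in> A \<and> z n \<in> A \<and> col (z n) = c \<and>
         word_dist (y n) (z n) \<le> 2 / p \<and> (\<forall>m. word_dist (y m) (y n) = d m n)))"
proof -
  define \<delta> where "\<delta> = 2 / real p"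
  have \<delta>: "\<delta> > 0" "\<delta> * p = 2" using p by (simp_all add: \<delta>_def)
  \<comment> \<open>turns letters of Gowers' theorem into distances, reversing the order\<close>
  define h where "h a = \<delta> * real (p - a)" for a
  have h: "0 \<le> h a" "h a \<le> 2" "h p = 0" for a
  proof -
    have "\<delta> * real (p - a) \<le> \<delta> * real p"
      using \<delta>(1) by (intro mult_left_mono) auto
    then show "0 \<le> h a" "h a \<le> 2" "h p = 0" using \<delta> by (simp_all add: h_def)
  qed
  have h_shift: "h (a - t) = min 2 (h a + \<delta> * real t)" if "a \<le> p" for a t
  proof (cases "t \<le> a")
    case True
    with that have "h (a - t) = h a + \<delta> * real t"
      by (simp add: h_def of_nat_diff algebra_simps)
    then show ?thesis using h(2)[of "a - t"] by simp
  next
    case False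
    with that have "\<delta> * real p \<le> \<delta> * (real (p - a) + real t)"
      using \<delta>(1) by (intro mult_left_mono) auto
    then show ?thesis using False \<delta> by (simp add: h_def algebra_simps)
  qed
  have refl: "d i i = 0" for i using d(1) by (simp add: pseudometric_on_def)
  have nonneg: "0 \<le> d i j" for i j using pseudometric_on_nonneg[OF d(1)] by simp
  define R where "R = range (\<lambda>(a, i, j). min 2 (h a + d i j))"
  have h_R: "h a \<in> R" for a
    unfolding R_def by (intro image_eqI[of _ _ "(a, 0, 0)"]) (simp_all add: h refl)
  define A where "A = distance_words \<inter> lists R"
  have grid: "map h w \<in> A" if "p \<in> set w" for w
  proof -
    have "0 \<in> h ` set w" using that h(3) by (metis imageI)
    then show ?thesis using h(1,2) h_R by (auto simp: A_def distance_words_def)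
  qed
  have "countable A"
    unfolding A_def R_def by (intro countable_Int2 countable_lists countable_image) simp
  moreover have "A \<subseteq> distance_words" by (simp add: A_def)
  moreover have "\<exists>c<k. \<exists>y z. \<forall>n. y n \<in> A \<and> z n \<in> A \<and> col (z n) = c \<and>
       word_dist (y n) (z n) \<le> 2 / p \<and> (\<forall>m. word_dist (y m) (y n) = d m n)"
    if col: "\<forall>w\<in>A. col w < k" for col and k :: nat
  proof -
    have "col (map h w) < k" if "w \<in> words_of_max p" for w
      using that by (intro bspec[OF col] grid) (simp add: words_of_max_def)
    from gowers_shifted_words[of p "\<lambda>w. col (map h w)" k, OF this]
    obtain x c where c: "c < k" and x: "\<And>n. x n \<in> words_of_max p"
      and mono: "\<And>n s. s n = 0 \<Longrightarrow> col (map h (map (\<lambda>(a, i). a - s i) (blocks x n))) = c"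
      by blast
    define X where "X i = map h (x i)" for i
    have X: "X i \<in> distance_words" for i
      using grid[of "x i"] x[of i] by (simp add: X_def A_def words_of_max_def)
    have "X = (\<lambda>i. map h (x i))" by (rule ext) (simp add: X_def)
    then have code_X: "code X s n = map (\<lambda>(a, i). min 2 (h a + s i)) (blocks x n)" for s n
      by (simp add: code_def blocks_map case_prod_unfold comp_def)
    \<comment> \<open>rounding down violates the triangle inequality, but the \<open>z n\<close> only need to be close to the \<open>y n\<close>\<close>
    define t where "t n i = nat \<lfloor>d n i / \<delta>\<rfloor>" for n i
    have t: "\<bar>\<delta> * t n i - d n i\<bar> \<le> \<delta>" for n i
    proof -
      have "real (t n i) = of_int \<lfloor>d n i / \<delta>\<rfloor>"
        using nonneg[of n i] \<delta>(1) by (simp add: t_def)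
      then have "real (t n i) \<le> d n i / \<delta>" "d n i / \<delta> \<le> real (t n i) + 1"
        by linarith+
      then show ?thesis using \<delta>(1) by (simp add: field_simps abs_le_iff)
    qed
    have t0: "t n n = 0" for n by (simp add: t_def refl)
    define y where "y n = code X (d n) n" for n
    define z where "z n = map h (map (\<lambda>(a, i). a - t n i) (blocks x n))" for n
    have z_code: "z n = code X (\<lambda>i. \<delta> * t n i) n" for n
    proof -
      have "h (a - t n i) = min 2 (h a + \<delta> * t n i)" if "(a, i) \<in> set (blocks x n)" for a i
        using that x[of i] by (intro h_shift) (auto simp: set_blocks words_of_max_def)
      then show ?thesis
        unfolding z_def code_X map_map by (intro map_cong) auto
    qed
    have "y n \<in> A" for n
    proof -
      have "y n \<in> distance_words"
        unfolding y_def by (intro code_in_distance_words X nonneg refl)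
      moreover have "min 2 (h a + d n i) \<in> R" for a i
        unfolding R_def by (intro image_eqI[of _ _ "(a, n, i)"]) simp_all
      then have "set (y n) \<subseteq> R" by (auto simp: y_def code_X)
      ultimately show ?thesis by (auto simp: A_def)
    qed
    moreover have "z n \<in> A" for n
    proof -
      have "(p, n) \<in> set (blocks x n)"
        using x[of n] by (simp add: set_blocks words_of_max_def)
      then have "p \<in> set (map (\<lambda>(a, i). a - t n i) (blocks x n))"
        using t0[of n] by force
      then show ?thesis unfolding z_def by (rule grid)
    qed
    moreover have "col (z n) = c" for n
      unfolding z_def using t0 by (rule mono)
    moreover have "word_dist (y n) (z n) \<le> 2 / p" for n
    proof -
      have "near \<delta> (z n) (y n)"
        unfolding z_code y_def
        by (rule near_code[OF order_refl X]) (use t \<delta>(1) in \<open>simp_all add: t0 refl\<close>)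
      then show ?thesis
        using word_dist_le[of \<delta> "y n" "z n"] \<delta>(1) by (simp add: near_commute \<delta>_def)
    qed
    moreover have "word_dist (y m) (y n) = d m n" for m n
      unfolding y_def using X d by (rule word_dist_code)
    ultimately show ?thesis using c by blast
  qed
  ultimately show ?thesis by blast
qed

section \<open>Countable pseudometric spaces in Urysohn spaces\<close>

lemma embeds_finite_pseudometric_spaces:
  fixes d :: "nat \<Rightarrow> nat \<Rightarrow> real"
  assumes U: "embeds_finite_metric_spaces U" and d: "pseudometric_on UNIV d"
  shows "\<exists>g. range g \<subseteq> U \<and> (\<forall>i<n. \<forall>j<n. dist (g i) (g j) = d i j)"
proof -
  have refl: "d i i = 0" and sym: "d i j = d j i" and tri: "d i k \<le> d i j + d j k" for i j k
    using d by (auto simp: pseudometric_on_def)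
  have nonneg: "0 \<le> d i j" for i j
    using pseudometric_on_nonneg[OF d] by simp
  \<comment> \<open>one representative of each class of points at distance \<open>0\<close>\<close>
  define rep where "rep i = (LEAST j. d i j = 0)" for i
  have rep: "d i (rep i) = 0" for i
    unfolding rep_def by (rule LeastI[of _ i]) (rule refl)
  have d_rep: "d (rep i) (rep j) = d i j" for i j
    using rep[of i] rep[of j] tri[of "rep i" "rep j" i] tri[of i "rep j" j]
      tri[of i j "rep i"] tri[of "rep i" j "rep j"] sym[of i "rep i"] sym[of j "rep j"]
    by linarith
  have rep_eq: "rep i = rep j" if "d i j = 0" for i j
  proof -
    have "d i k = d j k" for k
      using that tri[of i k j] tri[of j k i] sym[of i j] by linarith
    then show ?thesis by (simp add: rep_def)
  qed
  have "Metric_space (rep ` {..n}) d"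
  proof unfold_locales
    show "d x y = 0 \<longleftrightarrow> x = y" if "x \<in> rep ` {..n}" "y \<in> rep ` {..n}" for x y
      using that rep_eq by (auto simp: refl d_rep)
  qed (rule nonneg sym tri)+
  then obtain f where f: "f ` rep ` {..n} \<subseteq> U"
    "\<And>x y. x \<in> rep ` {..n} \<Longrightarrow> y \<in> rep ` {..n} \<Longrightarrow> dist (f x) (f y) = d x y"
    using U[unfolded embeds_finite_metric_spaces_def, rule_format, of "rep ` {..n}" d] by auto
  show ?thesis
  proof (intro exI[of _ "\<lambda>i. f (rep (min i n))"] conjI allI impI)
    show "range (\<lambda>i. f (rep (min i n))) \<subseteq> U" using f(1) by auto
    show "dist (f (rep (min i n))) (f (rep (min j n))) = d i j" if "i < n" "j < n" for i j
      using that by (simp add: f(2) d_rep)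
  qed
qed

text \<open>Any embedding \<open>g\<close> of the first \<open>n + 1\<close> points can be moved by an isometry of \<open>U\<close> until it agrees with
  \<open>f\<close> on the first \<open>n\<close> points.\<close>
lemma extend_finite_embedding:
  fixes U :: "'u::metric_space set" and d :: "nat \<Rightarrow> nat \<Rightarrow> real"
  assumes U: "ultrahomogeneous U" "embeds_finite_metric_spaces U"
    and d: "pseudometric_on UNIV d"
    and f: "range f \<subseteq> U" "\<And>i j. i < n \<Longrightarrow> j < n \<Longrightarrow> dist (f i) (f j) = d i j"
  shows "\<exists>g. range g \<subseteq> U \<and> (\<forall>i<Suc n. \<forall>j<Suc n. dist (g i) (g j) = d i j) \<and>
    (\<forall>i<n. g i = f i)"
proof -
  obtain g where g: "range g \<subseteq> U"
    "\<And>i j. i < Suc n \<Longrightarrow> j < Suc n \<Longrightarrow> dist (g i) (g j) = d i j"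
    using embeds_finite_pseudometric_spaces[OF U(2) d, of "Suc n"] by blast
  define pick where "pick y = (SOME i. i < n \<and> g i = y)" for y
  have pick: "pick (g i) < n" "g (pick (g i)) = g i" if "i < n" for i
    using someI[of "\<lambda>j. j < n \<and> g j = g i" i] that by (simp_all add: pick_def)
  have pick_f: "f (pick (g i)) = f i" if "i < n" for i
  proof -
    have "dist (f (pick (g i))) (f i) = dist (g (pick (g i))) (g i)"
      using that pick(1)[OF that] f(2)[of "pick (g i)" i] g(2)[of "pick (g i)" i] by linarith
    then show ?thesis using pick[OF that] by simp
  qed
  have "isometry_on (g ` {..<n}) (f \<circ> pick)"
    unfolding isometry_on_def by (auto simp: pick_f f(2) g(2) less_SucI)
  moreover have "finite (g ` {..<n})" "g ` {..<n} \<subseteq> U" "(f \<circ> pick) ` g ` {..<n} \<subseteq> U"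
    using f(1) g(1) by auto
  ultimately have "\<exists>h. isometry_on U h \<and> h ` U = U \<and> (\<forall>x\<in>g ` {..<n}. h x = (f \<circ> pick) x)"
    using U(1)[unfolded ultrahomogeneous_def, rule_format, of "g ` {..<n}" "f \<circ> pick"] by blast
  then obtain h where h: "isometry_on U h" "h ` U = U"
    "\<And>x. x \<in> g ` {..<n} \<Longrightarrow> h x = (f \<circ> pick) x"
    by blast
  show ?thesis
  proof (intro exI[of _ "h \<circ> g"] conjI allI impI)
    show "range (h \<circ> g) \<subseteq> U" using g(1) h(2) by auto
    show "dist ((h \<circ> g) i) ((h \<circ> g) j) = d i j" if "i < Suc n" "j < Suc n" for i j
      using h(1) g(1) g(2)[OF that] unfolding isometry_on_def by (simp add: range_subsetD)
    show "(h \<circ> g) i = f i" if "i < n" for i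
      using that by (simp add: h(3) pick_f)
  qed
qed

lemma embeds_nat_pseudometric_spaces:
  fixes U :: "'u::metric_space set" and d :: "nat \<Rightarrow> nat \<Rightarrow> real"
  assumes U: "ultrahomogeneous U" "embeds_finite_metric_spaces U"
    and d: "pseudometric_on UNIV d"
  obtains g where "range g \<subseteq> U" "\<And>i j. dist (g i) (g j) = d i j"
proof -
  define P where "P n f \<longleftrightarrow> range f \<subseteq> U \<and> (\<forall>i<n. \<forall>j<n. dist (f i) (f j) = d i j)"
    for n and f :: "nat \<Rightarrow> 'u"
  define Q where "Q n f g \<longleftrightarrow> (\<forall>i<n. g i = f i)" for n and f g :: "nat \<Rightarrow> 'u"
  have "\<exists>F. \<forall>n. P n (F n) \<and> Q n (F n) (F (Suc n))"
  proof (rule dependent_nat_choice)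
    show "\<exists>f. P 0 f"
      using embeds_finite_pseudometric_spaces[OF U(2) d, of 0] by (auto simp: P_def)
    show "\<exists>g. P (Suc n) g \<and> Q n f g" if "P n f" for n f
    proof -
      have "range f \<subseteq> U" "\<And>i j. i < n \<Longrightarrow> j < n \<Longrightarrow> dist (f i) (f j) = d i j"
        using that by (simp_all add: P_def)
      then show ?thesis
        using extend_finite_embedding[OF U d, of f n] unfolding P_def Q_def by blast
    qed
  qed
  then obtain F where F: "\<And>n. P n (F n)" "\<And>n. Q n (F n) (F (Suc n))" by blast
  have stable: "F n i = F (Suc i) i" if "i < n" for i n
    using that
  proof (induction n)
    case (Suc n)
    show ?case
    proof (cases "i = n")
      case False
      then have "i < n" using Suc.prems by simp
      then show ?thesis using Suc.IH F(2)[of n] by (simp add: Q_def)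
    qed simp
  qed simp
  show ?thesis
  proof (rule that[of "\<lambda>i. F (Suc i) i"])
    show "range (\<lambda>i. F (Suc i) i) \<subseteq> U"
      using F(1) by (auto simp: P_def)
    show "dist (F (Suc i) i) (F (Suc j) j) = d i j" for i j
    proof -
      let ?n = "Suc (max i j)"
      have "dist (F ?n i) (F ?n j) = d i j"
        using F(1)[of ?n] by (simp add: P_def)
      then show ?thesis
        using stable[of i ?n] stable[of j ?n] by simp
    qed
  qed
qed

theorem embeds_countable_pseudometric_spaces:
  fixes U :: "'u::metric_space set" and d :: "'z \<Rightarrow> 'z \<Rightarrow> real"
  assumes U: "ultrahomogeneous U" "embeds_finite_metric_spaces U"
    and A: "countable A" "A \<noteq> {}" and d: "pseudometric_on A d"
  obtains g where "g ` A \<subseteq> U" "\<And>x y. x \<in> A \<Longrightarrow> y \<in> A \<Longrightarrow> dist (g x) (g y) = d x y"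
proof -
  define e where "e = from_nat_into A"
  have e: "e i \<in> A" for i using A(2) by (simp add: e_def from_nat_into)
  have "pseudometric_on UNIV (\<lambda>i j. d (e i) (e j))"
    using d e unfolding pseudometric_on_def by blast
  then obtain f where f: "range f \<subseteq> U" "\<And>i j. dist (f i) (f j) = d (e i) (e j)"
    using embeds_nat_pseudometric_spaces[OF U] by blast
  show ?thesis
  proof (rule that[of "\<lambda>x. f (to_nat_on A x)"])
    show "dist (f (to_nat_on A x)) (f (to_nat_on A y)) = d x y" if "x \<in> A" "y \<in> A" for x y
      using that A by (simp add: f(2) e_def)
  qed (use f(1) in auto)
qed

text \<open>A new point \<^const>\<open>None\<close> at distance \<open>1\<close> from all others does not violate the triangle inequality,
  since distances in \<open>A\<close> are at most \<open>2\<close>. Its image is the centre \<open>x0\<close>.\<close>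
lemma urysohn_unit_sphere_universal:
  fixes U :: "'u::metric_space set" and d :: "'z \<Rightarrow> 'z \<Rightarrow> real"
  assumes U: "ultrahomogeneous U" "embeds_finite_metric_spaces U"
    and A: "countable A" and d: "pseudometric_on A d"
    and d2: "\<And>x y. x \<in> A \<Longrightarrow> y \<in> A \<Longrightarrow> d x y \<le> 2"
  obtains x0 g where "x0 \<in> U" "g ` A \<subseteq> U" "\<And>x. x \<in> A \<Longrightarrow> dist (g x) x0 = 1"
    "\<And>x y. x \<in> A \<Longrightarrow> y \<in> A \<Longrightarrow> dist (g x) (g y) = d x y"
proof -
  define d' where "d' p q = (case (p, q) of (None, None) \<Rightarrow> 0 | (Some x, Some y) \<Rightarrow> d x y | _ \<Rightarrow> 1)"
    for p q
  have "pseudometric_on (insert None (Some ` A)) d'"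
    using d d2 pseudometric_on_nonneg[OF d] unfolding pseudometric_on_def d'_def
    by (auto split: option.splits)
  moreover have "countable (insert None (Some ` A))" using A by simp
  ultimately obtain g where g: "g ` insert None (Some ` A) \<subseteq> U"
    "\<And>p q. p \<in> insert None (Some ` A) \<Longrightarrow> q \<in> insert None (Some ` A) \<Longrightarrow> dist (g p) (g q) = d' p q"
    using embeds_countable_pseudometric_spaces[OF U] by blast
  show ?thesis
    by (rule that[of "g None" "g \<circ> Some"]) (use g in \<open>auto simp: d'_def\<close>)
qed

section \<open>The unit sphere of the Holmes space\<close>

text \<open>The distances to a dense sequence, normalised so as to be bounded and to vanish at \<open>x0\<close>.\<close>
lemma frechet_embedding:
  fixes U :: "'u::metric_space set"
  assumes C: "countable C" "U \<subseteq> closure C" and x0: "x0 \<in> U"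
  obtains i :: "'u \<Rightarrow> (nat \<Rightarrow>\<^sub>C real)" where "isometry_on U i" "i x0 = 0"
proof -
  define u where "u = from_nat_into C"
  have "C \<noteq> {}" using C x0 by auto
  then have ran: "range u = C" unfolding u_def using C(1) by (rule range_from_nat_into)
  have bc: "(\<lambda>n. dist x (u n) - dist x0 (u n)) \<in> bcontfun" for x
  proof (rule bcontfun_normI)
    show "norm (dist x (u n) - dist x0 (u n)) \<le> dist x x0" for n
      using dist_triangle[of x "u n" x0] dist_triangle[of x0 "u n" x] by (simp add: dist_commute)
  qed simp
  define i where "i x = Bcontfun (\<lambda>n. dist x (u n) - dist x0 (u n))" for x
  have app: "apply_bcontfun (i x) n = dist x (u n) - dist x0 (u n)" for x n
    unfolding i_def by (simp add: Bcontfun_inverse[OF bc])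
  have "dist (i x) (i y) = dist x y" if x: "x \<in> U" for x y
  proof (rule antisym)
    show "dist (i x) (i y) \<le> dist x y"
    proof (rule dist_bound)
      show "dist (apply_bcontfun (i x) n) (apply_bcontfun (i y) n) \<le> dist x y" for n
        using dist_triangle[of x "u n" y] dist_triangle[of y "u n" x]
        by (simp add: app dist_real_def dist_commute)
    qed
    show "dist x y \<le> dist (i x) (i y)"
    proof (rule field_le_epsilon)
      fix e :: real assume "0 < e"
      then obtain n where n: "dist (u n) x < e / 2"
        using x C(2) ran by (metis closure_approachable half_gt_zero rangeE subsetD)
      have "dist x y \<le> 2 * dist (u n) x + \<bar>dist x (u n) - dist y (u n)\<bar>"
        using dist_triangle[of x y "u n"] dist_commute[of "u n" x] dist_commute[of "u n" y] by linarith
      also have "\<bar>dist x (u n) - dist y (u n)\<bar> = dist (apply_bcontfun (i x) n) (apply_bcontfun (i y) n)"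
        by (simp add: app dist_real_def)
      also have "\<dots> \<le> dist (i x) (i y)" by (rule dist_bounded)
      finally show "dist x y \<le> dist (i x) (i y) + e" using n by simp
    qed
  qed
  moreover have "i x0 = 0"
    by (rule bcontfun_eqI) (simp add: app)
  ultimately show ?thesis by (intro that[of i]) (simp_all add: isometry_on_def)
qed

text \<open>Rational combinations of \<open>C\<close> are dense in the closed span. That they stay in \<open>span C\<close> allows them to
  be pulled back along a linear isometry onto the closed span.\<close>
lemma separable_closed_span:
  fixes C :: "'a::real_normed_vector set"
  assumes C: "countable C" "S \<subseteq> closure C"
  obtains B where "countable B" "B \<subseteq> span C" "closure (span S) \<subseteq> closure B"
proof -
  define B where "B = (\<lambda>l. \<Sum>(r, c)\<leftarrow>l. r *\<^sub>R c) ` lists (\<rat> \<times> C)"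
  have B_add: "x + y \<in> B" if "x \<in> B" "y \<in> B" for x y
  proof -
    obtain k where k: "x = (\<Sum>(r, c)\<leftarrow>k. r *\<^sub>R c)" "k \<in> lists (\<rat> \<times> C)"
      using \<open>x \<in> B\<close> unfolding B_def by blast
    obtain l where l: "y = (\<Sum>(r, c)\<leftarrow>l. r *\<^sub>R c)" "l \<in> lists (\<rat> \<times> C)"
      using \<open>y \<in> B\<close> unfolding B_def by blast
    have "x + y = (\<Sum>(r, c)\<leftarrow>k @ l. r *\<^sub>R c)" "k @ l \<in> lists (\<rat> \<times> C)"
      using k l by simp_all
    then show ?thesis unfolding B_def by blast
  qed
  have B_scale: "q *\<^sub>R x \<in> B" if q: "q \<in> \<rat>" and "x \<in> B" for q x
  proof -
    obtain l where l: "x = (\<Sum>(r, c)\<leftarrow>l. r *\<^sub>R c)" "l \<in> lists (\<rat> \<times> C)"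
      using \<open>x \<in> B\<close> unfolding B_def by blast
    have "q *\<^sub>R x = (\<Sum>(r, c)\<leftarrow>map (\<lambda>(r, c). (q * r, c)) l. r *\<^sub>R c)"
      unfolding l(1) by (induction l) (auto simp: scaleR_add_right)
    moreover have "map (\<lambda>(r, c). (q * r, c)) l \<in> lists (\<rat> \<times> C)"
      using l(2) q by (auto simp: in_lists_conv_set)
    ultimately show ?thesis unfolding B_def by blast
  qed
  have "C \<subseteq> B"
  proof
    fix c assume "c \<in> C"
    then show "c \<in> B"
      unfolding B_def by (intro image_eqI[of _ _ "[(1, c)]"]) auto
  qed
  have "subspace (closure B)"
  proof (rule subspaceI)
    have "0 \<in> B" unfolding B_def by (intro image_eqI[of _ _ "[]"]) auto
    then show "0 \<in> closure B" using closure_subset by blast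
    have "(\<lambda>(x, y). x + y) ` closure (B \<times> B) \<subseteq> closure B"
    proof (rule image_closure_subset)
      show "continuous_on (closure (B \<times> B)) (\<lambda>(x, y). x + y)"
        unfolding case_prod_unfold by (intro continuous_intros)
      show "(\<lambda>(x, y). x + y) ` (B \<times> B) \<subseteq> closure B"
        using B_add by (auto intro: subsetD[OF closure_subset])
    qed simp
    then show "x + y \<in> closure B" if "x \<in> closure B" "y \<in> closure B" for x y
      using that by (auto simp: closure_Times image_subset_iff)
    have "(\<lambda>(r, x). r *\<^sub>R x) ` closure (\<rat> \<times> B) \<subseteq> closure B"
    proof (rule image_closure_subset)
      show "continuous_on (closure (\<rat> \<times> B)) (\<lambda>(r, x). r *\<^sub>R x)"
        unfolding case_prod_unfold by (intro continuous_intros)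
      show "(\<lambda>(r, x). r *\<^sub>R x) ` (\<rat> \<times> B) \<subseteq> closure B"
        using B_scale by (auto intro: subsetD[OF closure_subset])
    qed simp
    then show "r *\<^sub>R x \<in> closure B" if "x \<in> closure B" for r x
      using that by (auto simp: closure_Times image_subset_iff Rats_closure_real)
  qed
  moreover have "S \<subseteq> closure B"
    using C(2) closure_mono[OF \<open>C \<subseteq> B\<close>] by blast
  ultimately have "span S \<subseteq> closure B" by (simp add: span_minimal)
  then have "closure (span S) \<subseteq> closure B" by (simp add: closure_minimal)
  moreover have "countable B"
    unfolding B_def using C(1) by (intro countable_image countable_lists countable_SIGMA countable_rat)
  moreover have "B \<subseteq> span C"
  proof -
    have "(\<Sum>(r, c)\<leftarrow>l. r *\<^sub>R c) \<in> span C" if "l \<in> lists (\<rat> \<times> C)" for l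
      using that
    proof (induction l)
      case (Cons p l)
      then show ?case by (cases p) (auto intro: span_add span_scale span_base)
    qed (simp add: span_zero)
    then show ?thesis by (auto simp: B_def)
  qed
  ultimately show ?thesis using that by blast
qed

text \<open>The universal property, applied to a Frechet embedding of \<open>U\<close>, carries over to the Holmes space both
  the copy of \<open>U\<close> and the separability of its closed span.\<close>
lemma holmes_space_embedding:
  fixes U :: "'u::metric_space set"
  assumes sep: "separable_space (top_of_set U)" and x0: "x0 \<in> U"
    and holmes: "holmes_space U TYPE('h::banach)"
  obtains j :: "'u \<Rightarrow> 'h::banach" and B :: "'h set"
  where "isometry_on U j" "j x0 = 0" "countable B" "closure B = UNIV"
proof -
  obtain C where C: "countable C" "C \<subseteq> U" "top_of_set U closure_of C = U"
    using sep by (auto simp: separable_space_def)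
  then have UC: "U \<subseteq> closure C"
    by (auto simp: closure_of_subtopology Int_absorb1)
  obtain i :: "'u \<Rightarrow> (nat \<Rightarrow>\<^sub>C real)" where i: "isometry_on U i" "i x0 = 0"
    using frechet_embedding[OF C(1) UC x0] .
  have "0 \<in> i ` U" using i(2) x0 by force
  then obtain T :: "'h \<Rightarrow> (nat \<Rightarrow>\<^sub>C real)" where T: "linear T" "\<And>x. norm (T x) = norm x"
    "range T = closure (span (i ` U))"
    using holmes i(1)
    unfolding holmes_space_def holmes_property_def isometrically_isomorphic_to_def by blast
  have dist_T: "dist (T x) (T y) = dist x y" for x y
    by (simp add: dist_norm T(2) flip: linear_diff[OF T(1)])
  have "inj T" by (rule injI) (metis dist_T dist_eq_0_iff)
  have i_range: "i x \<in> range T" if "x \<in> U" for x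
    unfolding T(3) using that closure_subset[of "span (i ` U)"] span_superset[of "i ` U"] by blast
  define j where "j x = inv T (i x)" for x
  have Tj: "T (j x) = i x" if "x \<in> U" for x
    using i_range[OF that] by (simp add: j_def f_inv_into_f)
  have "isometry_on U j"
    using i(1) Tj dist_T unfolding isometry_on_def by metis
  moreover have "j x0 = 0"
    using Tj[OF x0] T(2)[of "j x0"] by (simp add: i(2))
  moreover have "i ` U \<subseteq> closure (i ` C)"
  proof -
    have "i x \<in> closure (i ` C)" if x: "x \<in> U" for x
    proof -
      have "\<exists>c\<in>C. dist (i c) (i x) < e" if "0 < e" for e
        using x C(2) UC i(1) that unfolding isometry_on_def
        by (metis closure_approachable subsetD)
      then show ?thesis by (auto simp: closure_approachable)
    qed
    then show ?thesis by blast
  qed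
  then obtain B where B: "countable B" "B \<subseteq> span (i ` C)" "closure (span (i ` U)) \<subseteq> closure B"
    using separable_closed_span[of "i ` C" "i ` U"] C(1) by auto
  have B_range: "B \<subseteq> range T"
    unfolding T(3)
    using B(2) span_mono[OF image_mono[OF C(2)], of i] closure_subset[of "span (i ` U)"] by blast
  have "countable (T -` B)"
    by (rule countable_subset[OF _ countable_image[OF B(1), of "inv T"]])
       (auto simp: inv_f_f[OF \<open>inj T\<close>] intro!: image_eqI[of _ _ "T _"])
  moreover have "closure (T -` B) = UNIV"
  proof -
    have "\<exists>b\<in>T -` B. dist b x < e" if "0 < e" for x e
    proof -
      have "T x \<in> closure B" using B(3) T(3) by blast
      then obtain b where "b \<in> B" "dist b (T x) < e"
        using \<open>0 < e\<close> by (metis closure_approachable)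
      moreover then obtain b' where "b = T b'" using B_range by blast
      ultimately show ?thesis using dist_T by auto
    qed
    then show ?thesis by (auto simp: closure_approachable)
  qed
  ultimately show ?thesis using that by blast
qed

lemma separable_sphere:
  fixes B :: "'a::real_normed_vector set"
  assumes B: "countable B" "closure B = UNIV"
  obtains Q where "countable Q" "Q \<subseteq> sphere 0 1" "closure Q = (sphere 0 1 :: 'a set)"
proof -
  define Q where "Q = sgn ` (B - {0})"
  have closed_unit_sphere: "closed (sphere 0 1 :: 'a set)"
    unfolding sphere_def by (intro closed_Collect_eq continuous_intros)
  have Q: "Q \<subseteq> sphere 0 1" by (auto simp: Q_def norm_sgn split: if_splits)
  have "s \<in> closure Q" if s: "s \<in> sphere 0 1" for s
  proof -
    have "s \<in> closure B" using B(2) by simp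
    then obtain b where b: "\<And>n. b n \<in> B" "b \<longlonglongrightarrow> s"
      unfolding closure_sequential by blast
    have "s \<noteq> 0" using s by auto
    then have "\<forall>\<^sub>F n in sequentially. b n \<noteq> 0"
      using b(2) tendsto_imp_eventually_ne by blast
    then have "\<forall>\<^sub>F n in sequentially. sgn (b n) \<in> closure Q"
      by eventually_elim (use b(1) closure_subset[of Q] in \<open>auto simp: Q_def\<close>)
    moreover have "(\<lambda>n. sgn (b n)) \<longlonglongrightarrow> sgn s"
      using b(2) \<open>s \<noteq> 0\<close> by (rule tendsto_sgn)
    moreover have "sgn s = s" using s by (simp add: sgn_div_norm)
    ultimately show ?thesis
      by (metis closed_closure Lim_in_closed_set trivial_limit_sequentially)
  qed
  then have "closure Q = sphere 0 1"
    using closure_minimal[OF Q] closed_unit_sphere by blast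
  moreover have "countable Q" using B(1) by (simp add: Q_def)
  ultimately show ?thesis using Q that by blast
qed

lemma isometry_extends_to_closure:
  fixes h :: "'a::metric_space \<Rightarrow> 'b::complete_space"
  assumes h: "isometry_on Q h"
  obtains f where "isometry_on (closure Q) f" "\<And>x. x \<in> Q \<Longrightarrow> f x = h x"
proof -
  have "uniformly_continuous_on Q h"
    using h by (auto simp: uniformly_continuous_on_def isometry_on_def)
  then obtain f where f: "uniformly_continuous_on (closure Q) f" "\<And>x. x \<in> Q \<Longrightarrow> h x = f x"
    using uniformly_continuous_on_extension_on_closure by metis
  then have cont: "continuous_on (closure Q) f"
    by (simp add: uniformly_continuous_imp_continuous)
  have "dist (f x) (f y) = dist x y" if xy: "x \<in> closure Q" "y \<in> closure Q" for x y
  proof -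
    obtain a b where a: "\<And>n. a n \<in> Q" "a \<longlonglongrightarrow> x" and b: "\<And>n. b n \<in> Q" "b \<longlonglongrightarrow> y"
      using xy unfolding closure_sequential by blast
    have "(\<lambda>n. f (a n)) \<longlonglongrightarrow> f x" "(\<lambda>n. f (b n)) \<longlonglongrightarrow> f y"
      using cont xy a b closure_subset unfolding continuous_on_sequentially comp_def
      by (meson subsetD)+
    then have "(\<lambda>n. dist (f (a n)) (f (b n))) \<longlonglongrightarrow> dist (f x) (f y)"
      by (rule tendsto_dist)
    moreover have "dist (f (a n)) (f (b n)) = dist (a n) (b n)" for n
      using a(1) b(1) h by (simp add: isometry_on_def flip: f(2))
    moreover have "(\<lambda>n. dist (a n) (b n)) \<longlonglongrightarrow> dist x y"
      using a(2) b(2) by (rule tendsto_dist)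
    ultimately show ?thesis using LIMSEQ_unique by auto
  qed
  with f(2) that show ?thesis by (metis isometry_on_def)
qed

lemma isometry_on_imp_isometric:
  assumes "isometry_on X f"
  shows "isometric (f ` X) X"
proof -
  have inj: "inj_on f X"
  proof (rule inj_onI)
    fix x y assume xy: "x \<in> X" "y \<in> X" "f x = f y"
    have "dist (f x) (f y) = dist x y"
      using assms xy(1,2) unfolding isometry_on_def by blast
    then show "x = y" using xy(3) by simp
  qed
  then have "isometry_on (f ` X) (inv_into X f)"
    using assms by (simp add: isometry_on_def)
  moreover have "inv_into X f ` f ` X = X" using inj by simp
  ultimately show ?thesis unfolding isometric_def by blast
qed

lemma holmes_sphere_universal:
  fixes U :: "'u::metric_space set" and d :: "'z \<Rightarrow> 'z \<Rightarrow> real"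
  assumes U: "urysohn_space U" and holmes: "holmes_space U TYPE('h::banach)"
    and A: "countable A" "pseudometric_on A d" "\<And>x y. x \<in> A \<Longrightarrow> y \<in> A \<Longrightarrow> d x y \<le> 2"
  shows "\<exists>g :: 'z \<Rightarrow> 'h. g ` A \<subseteq> sphere 0 1 \<and> (\<forall>x\<in>A. \<forall>y\<in>A. dist (g x) (g y) = d x y)"
proof -
  have U': "separable_space (top_of_set U)" "ultrahomogeneous U" "embeds_finite_metric_spaces U"
    using U by (simp_all add: urysohn_space_def)
  obtain x0 f where x0: "x0 \<in> U" and f: "f ` A \<subseteq> U" "\<And>x. x \<in> A \<Longrightarrow> dist (f x) x0 = 1"
    "\<And>x y. x \<in> A \<Longrightarrow> y \<in> A \<Longrightarrow> dist (f x) (f y) = d x y"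
    using urysohn_unit_sphere_universal[OF U'(2,3) A] by blast
  obtain j :: "'u \<Rightarrow> 'h" where j: "isometry_on U j" "j x0 = 0"
    using holmes_space_embedding[OF U'(1) x0 holmes] by blast
  show ?thesis
  proof (intro exI[of _ "j \<circ> f"] conjI ballI)
    show "(j \<circ> f) ` A \<subseteq> sphere 0 1"
    proof
      fix v assume "v \<in> (j \<circ> f) ` A"
      then obtain x where x: "x \<in> A" "v = j (f x)" by auto
      then have "dist (j (f x)) (j x0) = 1"
        using f(1,2) j(1) x0 by (auto simp: isometry_on_def image_subset_iff)
      then show "v \<in> sphere 0 1" using x(2) j(2) by (simp add: dist_commute)
    qed
    show "dist ((j \<circ> f) x) ((j \<circ> f) y) = d x y" if "x \<in> A" "y \<in> A" for x y
      using that f(1,3) j(1) by (auto simp: isometry_on_def image_subset_iff)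
  qed
qed

lemma holmes_sphere_separable:
  fixes U :: "'u::metric_space set"
  assumes U: "urysohn_space U" and holmes: "holmes_space U TYPE('h::banach)"
  obtains Q :: "'h::banach set" where "countable Q" "Q \<noteq> {}" "closure Q = sphere 0 1"
proof -
  have "separable_space (top_of_set U)" "embeds_finite_metric_spaces U"
    using U by (simp_all add: urysohn_space_def)
  moreover have "pseudometric_on UNIV (\<lambda>_ _::nat. 0)" by (simp add: pseudometric_on_def)
  ultimately obtain x0 where x0: "x0 \<in> U"
    using embeds_finite_pseudometric_spaces[of U "\<lambda>_ _. 0" 0] by blast
  obtain j :: "'u \<Rightarrow> 'h" and B :: "'h set"
    where "isometry_on U j" "j x0 = 0" and B: "countable B" "closure B = UNIV"
    using holmes_space_embedding[OF \<open>separable_space (top_of_set U)\<close> x0 holmes] .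
  obtain Q :: "'h set" where Q: "countable Q" "Q \<subseteq> sphere 0 1" "closure Q = sphere 0 1"
    using separable_sphere[OF B] .
  have "pseudometric_on {()} (\<lambda>_ _. 0)" by (simp add: pseudometric_on_def)
  then have "\<exists>g :: unit \<Rightarrow> 'h. g ` {()} \<subseteq> sphere 0 1 \<and> (\<forall>x\<in>{()}. \<forall>y\<in>{()}. dist (g x) (g y) = 0)"
    by (intro holmes_sphere_universal[OF U holmes]) auto
  then have "Q \<noteq> {}" using Q(3) by auto
  with Q that show ?thesis by blast
qed

text \<open>The sphere is coloured; its colouring is pulled back to the words. The copy of the sphere is the
  image of the isometry \<open>f\<close> that sends the dense sequence \<open>q\<close> to the words \<open>y\<close>. Half of \<open>\<epsilon>\<close> is spent on
  replacing a point by some \<open>y n\<close>, the other half on passing from \<open>y n\<close> to \<open>z n\<close>.\<close>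
theorem theorem75:
  fixes U :: "'u::metric_space set"
  assumes "urysohn_space U"
    and "holmes_space U TYPE('h::banach)"
  shows "approximately_indivisible (sphere (0::'h) 1)"
  unfolding approximately_indivisible_def eps_indivisible_def
proof (intro allI impI ballI)
  fix \<epsilon> :: real and k :: nat and c :: "'h \<Rightarrow> nat"
  assume \<epsilon>: "\<epsilon> > 0" and c: "c \<in> sphere 0 1 \<rightarrow> {..<k}"
  obtain Q :: "'h set" where Q: "countable Q" "Q \<noteq> {}" "closure Q = sphere 0 1"
    using holmes_sphere_separable[OF assms] .
  define q where "q = from_nat_into Q"
  define idx where "idx = to_nat_on Q"
  have q_idx: "q (idx x) = x" if "x \<in> Q" for x
    using that Q(1) by (simp add: q_def idx_def)
  have q: "q n \<in> sphere 0 1" for n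
    using from_nat_into[OF Q(2), of n] closure_subset[of Q] Q(3) by (auto simp: q_def)
  define d where "d m n = dist (q m) (q n)" for m n
  have "pseudometric_on UNIV d"
    by (auto simp: pseudometric_on_def d_def dist_commute dist_triangle)
  moreover have "d m n \<le> 2" for m n
    using dist_triangle[of "q m" "q n" 0] q[of m] q[of n] by (simp add: d_def)
  moreover obtain p :: nat where p: "4 / \<epsilon> < p" using reals_Archimedean2 by blast
  moreover from this have "p > 0" using \<epsilon> by (metis divide_pos_pos of_nat_0_less_iff order_less_trans zero_less_numeral)
  ultimately obtain A where A: "countable A" "A \<subseteq> distance_words"
    and colour: "\<forall>col (k::nat). (\<forall>w\<in>A. col w < k) \<longrightarrow>
       (\<exists>c<k. \<exists>y z. \<forall>n. y n \<in> A \<and> z n \<in> A \<and> col (z n) = c \<and>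
         word_dist (y n) (z n) \<le> 2 / p \<and> (\<forall>m. word_dist (y m) (y n) = d m n))"
    using words_near_one_colour[of d p] by auto
  have "pseudometric_on A word_dist"
    using A(2) pseudometric_on_word_dist unfolding pseudometric_on_def by blast
  then have "\<exists>g :: real list \<Rightarrow> 'h. g ` A \<subseteq> sphere 0 1 \<and>
      (\<forall>v\<in>A. \<forall>w\<in>A. dist (g v) (g w) = word_dist v w)"
    by (intro holmes_sphere_universal[OF assms A(1)] word_dist_le_2)
  then obtain g :: "real list \<Rightarrow> 'h" where g: "g ` A \<subseteq> sphere 0 1"
    "\<And>v w. v \<in> A \<Longrightarrow> w \<in> A \<Longrightarrow> dist (g v) (g w) = word_dist v w"
    by blast
  have "c (g w) < k" if "w \<in> A" for w
    using c g(1) that by auto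
  then obtain i y z where i: "i < k" and yz: "\<And>n. y n \<in> A" "\<And>n. z n \<in> A"
    "\<And>n. c (g (z n)) = i" "\<And>n. word_dist (y n) (z n) \<le> 2 / p"
    "\<And>m n. word_dist (y m) (y n) = d m n"
    using colour[rule_format, of "\<lambda>w. c (g w)" k] by blast
  have "isometry_on Q (\<lambda>x. g (y (idx x)))"
    by (simp add: isometry_on_def g(2) yz d_def q_idx)
  then obtain f where f: "isometry_on (sphere 0 1) f" "\<And>x. x \<in> Q \<Longrightarrow> f x = g (y (idx x))"
    using isometry_extends_to_closure unfolding Q(3)[symmetric] by blast
  have "f ` sphere 0 1 \<subseteq> closed_nbhd (sphere 0 1) \<epsilon> (c -` {i} \<inter> sphere 0 1)"
  proof
    fix v assume "v \<in> f ` sphere 0 1"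
    then obtain s where s: "s \<in> sphere 0 1" "v = f s" by blast
    have approached: "\<exists>n. dist v (g (y n)) < e" if "e > 0" for e
    proof -
      obtain a where a: "a \<in> Q" "dist a s < e"
        using s(1) \<open>e > 0\<close> unfolding Q(3)[symmetric] closure_approachable by blast
      then have "dist v (g (y (idx a))) = dist s a"
        using s f(1) closure_subset[of Q] Q(3) by (simp add: f(2)[symmetric] isometry_on_def subset_iff)
      with a(2) show ?thesis by (metis dist_commute)
    qed
    then have "v \<in> closure (sphere 0 1)"
      using g(1) yz(1) unfolding closure_approachable by (metis dist_commute image_subset_iff)
    then have "v \<in> sphere 0 1"
      unfolding Q(3)[symmetric] by simp
    obtain n where "dist v (g (y n)) < 2 / p"
      using approached[of "2 / p"] \<open>p > 0\<close> by auto
    moreover have "dist (g (y n)) (g (z n)) \<le> 2 / p"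
      using yz(4)[of n] g(2)[OF yz(1,2)[of n]] by simp
    moreover have "2 / p + 2 / p \<le> \<epsilon>"
      using p \<epsilon> \<open>p > 0\<close> by (simp add: field_simps)
    ultimately have "dist v (g (z n)) \<le> \<epsilon>"
      using dist_triangle[of v "g (z n)" "g (y n)"] by linarith
    moreover have "g (z n) \<in> sphere 0 1"
      using g(1) yz(2)[of n] by blast
    then have "g (z n) \<in> c -` {i} \<inter> sphere 0 1"
      using yz(3)[of n] by simp
    ultimately show "v \<in> closed_nbhd (sphere 0 1) \<epsilon> (c -` {i} \<inter> sphere 0 1)"
      using \<open>v \<in> sphere 0 1\<close> unfolding closed_nbhd_def by blast
  qed
  moreover from this have "f ` sphere 0 1 \<subseteq> sphere 0 1"
    by (auto simp: closed_nbhd_def)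
  moreover have "isometric (f ` sphere 0 1) (sphere (0::'h) 1)"
    using f(1) by (rule isometry_on_imp_isometric)
  ultimately show "\<exists>i<k. \<exists>X'\<subseteq>sphere (0::'h) 1. isometric X' (sphere (0::'h) 1) \<and>
      X' \<subseteq> closed_nbhd (sphere 0 1) \<epsilon> (c -` {i} \<inter> sphere 0 1)"
    using i \<open>f ` sphere 0 1 \<subseteq> sphere 0 1\<close>
    by (intro exI[of _ i] exI[of _ "f ` sphere 0 1"] conjI)
qed

end
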